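(* Let $E\subset\mathbb{T}$ be a nonempty closed set, and let $\alpha\in\mathbb{R}$ be such that $I(\alpha,E)<\infty$. Let $D,q\ge 0$, and let $f\not\equiv0$ be an analytic function in $\mathbb{D}$ such that $$|f(z)|\le\exp\Bigl(\frac{D}{\rho^q(z,E)}\Bigr),\qquad z\in\mathbb{D}.$$ Then $$\sum_{z\in Z_f}(1-|z|)\,\rho(z,E)^{(q-\alpha)_+}<\infty.$$ Moreover, there is a constant $C(q,\alpha,E)$, depending only on $q,\alpha,E$ (and not on $f$ or $D$), such that if in addition $|f(0)|\ge1$, then $$\sum_{z\in Z_f}(1-|z|)\,\rho(z,E)^{(q-\alpha)_+}\le C(q,\alpha,E)\,D.$$ In the case $q>\alpha$ one can take $C(q,\alpha,E)=36\bigl(2^{-\alpha}+q\,(90)^{q-\alpha}\,I(\alpha,E)\bigr)$.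
   Context: $\mathbb{D}=\{z\in\mathbb{C}:|z|<1\}$ is the open unit disk and $\mathbb{T}=\{z\in\mathbb{C}:|z|=1\}$ the unit circle. $x_+=\max\{x,0\}$. For a closed set $E\subset\mathbb{T}$, $\rho(z,E)=\mathrm{dist}(z,E)$ is the Euclidean distance from $z$ to $E$, and $\rho^q(z,E)=(\rho(z,E))^q$. For $t>0$ put $E_t=\{\zeta\in\mathbb{T}:\rho(\zeta,E)<t\}$ and $\nu_E(t)=|E_t|$, where $|A|$ denotes the normalized Lebesgue measure of $A\subset\mathbb{T}$ (so $|\mathbb{T}|=1$). For $\alpha\in\mathbb{R}$, $$I(\alpha,E)=\int_0^2\frac{\nu_E(s)}{s^{\alpha+1}}\,ds\in[0,+\infty].$$ $Z_f$ is the zero set of $f$ in $\mathbb{D}$, each zero being counted according to its multiplicity (so sums over $Z_f$ repeat each zero as many times as its multiplicity). *)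

theory Defs
  imports "HOL-Complex_Analysis.Complex_Analysis"
begin

text \<open>
  The Euclidean distance from \<open>z\<close> to \<open>E\<close> is \<^term>\<open>infdist z E\<close>; it is only used for nonempty \<open>E\<close>.
\<close>

text \<open>Normalized Lebesgue (arc length) measure on the unit circle, as a Borel measure
  on the complex plane.\<close>

definition circle_measure :: "complex measure" where
  "circle_measure = distr (uniform_measure lborel {0..<2*pi}) borel cis"

definition circle_nbhd :: "complex set \<Rightarrow> real \<Rightarrow> complex set" where
  "circle_nbhd E t = {\<zeta> \<in> sphere 0 1. infdist \<zeta> E < t}"

definition nu :: "complex set \<Rightarrow> real \<Rightarrow> real" where
  "nu E t = measure circle_measure (circle_nbhd E t)"

definition I_integral :: "real \<Rightarrow> complex set \<Rightarrow> ennreal" where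
  "I_integral \<alpha> E = (\<integral>\<^sup>+ s\<in>{0..2}. ennreal (nu E s / s powr (\<alpha> + 1)) \<partial>lborel)"

definition disk_zeros :: "(complex \<Rightarrow> complex) \<Rightarrow> complex set" where
  "disk_zeros f = {z \<in> ball 0 1. f z = 0}"

text \<open>The summand of the Blaschke-type sum over the distinct zeros: the multiplicity of a zero
  enters as the factor \<^term>\<open>zorder f z\<close>. For \<open>z\<close> in the disk and \<open>E\<close> in the circle the base of
  the power is positive, so exponent \<open>0\<close> gives the factor \<open>1\<close>.\<close>

definition zero_term ::
  "real \<Rightarrow> real \<Rightarrow> complex set \<Rightarrow> (complex \<Rightarrow> complex) \<Rightarrow> complex \<Rightarrow> real" where
  "zero_term q \<alpha> E f z =
     of_int (zorder f z) * ((1 - norm z) * infdist z E powr (max (q - \<alpha>) 0))"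

definition growth_class ::
  "real \<Rightarrow> real \<Rightarrow> complex set \<Rightarrow> (complex \<Rightarrow> complex) set" where
  "growth_class D q E =
     {f. f analytic_on ball 0 1 \<and> (\<exists>z\<in>ball 0 1. f z \<noteq> 0) \<and>
         (\<forall>z\<in>ball 0 1. norm (f z) \<le> exp (D / infdist z E powr q))}"

end

(* The maximum principle replaces potential theory. Write rho for the distance to E, and fix a scale
   t and finitely many zeros a with rho(a) >= 90 t. On {|z| < r, rho(z) > t}, with r -> 1, divide f by
   the Blaschke factors of these zeros, each multiplied by exp(K_a), and by exp(8 D H). Here H is the
   Schwarz integral of max(t, rho)^(-q), and Re K_a is the Poisson integral of a multiple of t times
   the Poisson kernel of a, cut off near E, so that |B_a exp(K_a)| >= 1 where rho = t. Moving a far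
   from E (relative to t) makes Re K_a(0) at most 2/3 (1 - |a|), so evaluation at 0 bounds the sum of
   1 - |a| over these zeros by 24 D times the mean of max(t, rho)^(-q) over the circle. The layer cake
   formula turns this mean into an integral of nu_E, and integrating over t = s/90 against
   s^(q - alpha - 1) ds produces I(alpha, E). *)

theory Submission
  imports Defs
begin

section \<open>Schwarz and Poisson integrals\<close>

text \<open>The first term of the stated constant, 36 * 2^(-\<alpha>), does not grow with q, so
  bounding Re H from below where rho = t must not lose a factor such as 2^q. It does not: if e is
  the point of E nearest to z, then z sees with harmonic measure at least 1/8 an arc on which
  |\<zeta> - e| \<le> |z - e|, so the truncated power keeps its full value t^(-q) there. This is the
  8 in 8 D H. Truncation is forced, as rho^(-q) may fail to be integrable on the circle.

  Where rho = t inside the disk, log 1/|B_a| is genuinely positive, of size up to t times the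
  Poisson kernel of a. Adding a multiple of the full kernel would repair this, but its mean is a
  multiple of t, not of 1 - |a|. The cutoff keeps the values near z, and on its support |\<zeta> -
  a| \<ge> 88 t, which makes the mean at most 2/3 (1 - |a|). The factor 9 of the kernel exceeds 8
  just enough to pay for the harmonic measure 1/8 and for second-order terms, and 90 is large enough
  that 9 pi / 88 < 1/3. The remaining third yields 24 = 8 * 3, below the 36 claimed.\<close>

definition schwarz_integral :: "(complex \<Rightarrow> real) \<Rightarrow> complex \<Rightarrow> complex" where
  "schwarz_integral g z =
     integral (cbox 0 (2*pi)) (\<lambda>\<phi>. (cis \<phi> + z) / (cis \<phi> - z) * of_real (g (cis \<phi>))) / of_real (2*pi)"

lemma continuous_on_circle_param:
  assumes "continuous_on (sphere 0 1) g"
  shows "continuous_on S (\<lambda>\<phi>. g (cis \<phi>))"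
  by (rule continuous_on_compose2[OF assms]) (auto intro!: continuous_intros)

lemma cis_diff_nonzero: "norm z < 1 \<Longrightarrow> cis \<phi> - z \<noteq> 0"
  by (metis eq_iff_diff_eq_0 less_irrefl norm_cis)

lemma schwarz_integral_holomorphic:
  assumes g: "continuous_on (sphere 0 1) g"
  shows "schwarz_integral g holomorphic_on ball 0 1"
proof -
  have g2: "continuous_on (ball 0 1 \<times> cbox 0 (2*pi)) (\<lambda>x. g (cis (snd x)))"
    by (rule continuous_on_compose2[OF g]) (auto intro!: continuous_intros)
  have "(\<lambda>z. integral (cbox 0 (2*pi))
          (\<lambda>\<phi>. (cis \<phi> + z) / (cis \<phi> - z) * of_real (g (cis \<phi>)))) holomorphic_on ball 0 1"
  proof (rule leibniz_rule_holomorphic[where fx = "\<lambda>z \<phi>. 2 * cis \<phi> / (cis \<phi> - z)^2 * of_real (g (cis \<phi>))"])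
    fix z :: complex and \<phi> :: real
    assume "z \<in> ball 0 1"
    then have "cis \<phi> - z \<noteq> 0" using cis_diff_nonzero by simp
    then show "((\<lambda>z. (cis \<phi> + z) / (cis \<phi> - z) * of_real (g (cis \<phi>))) has_field_derivative
      2 * cis \<phi> / (cis \<phi> - z)^2 * of_real (g (cis \<phi>))) (at z within ball 0 1)"
      by (auto intro!: derivative_eq_intros simp: power2_eq_square algebra_simps)
  next
    fix z :: complex
    assume "z \<in> ball 0 1"
    then have "\<And>\<phi>. cis \<phi> - z \<noteq> 0" using cis_diff_nonzero by simp
    then show "(\<lambda>\<phi>. (cis \<phi> + z) / (cis \<phi> - z) * of_real (g (cis \<phi>))) integrable_on cbox 0 (2*pi)"
      by (intro integrable_continuous continuous_intros continuous_on_circle_param[OF g]) auto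
  next
    show "continuous_on (ball 0 1 \<times> cbox 0 (2*pi))
      (\<lambda>(z, \<phi>). 2 * cis \<phi> / (cis \<phi> - z)\<^sup>2 * of_real (g (cis \<phi>)))"
      unfolding case_prod_unfold using cis_diff_nonzero
      by (intro continuous_intros g2) auto
  qed auto
  then show ?thesis unfolding schwarz_integral_def
    by (intro holomorphic_intros) auto
qed

lemma Re_schwarz_kernel:
  assumes "norm z < 1"
  shows "Re ((cis \<phi> + z) / (cis \<phi> - z)) = (1 - (norm z)\<^sup>2) / (norm (cis \<phi> - z))\<^sup>2"
proof -
  have "Re ((cis \<phi> + z) / (cis \<phi> - z)) = Re ((cis \<phi> + z) * cnj (cis \<phi> - z)) / (norm (cis \<phi> - z))\<^sup>2"
    by (simp add: complex_div_cnj[of "cis \<phi> + z"] Re_divide_of_real flip: of_real_power)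
  also have "Re ((cis \<phi> + z) * cnj (cis \<phi> - z)) = (norm (cis \<phi>))\<^sup>2 - (norm z)\<^sup>2"
    unfolding cmod_power2 by (simp add: power2_eq_square algebra_simps)
  finally show ?thesis by simp
qed

lemma Re_schwarz_integral:
  assumes g: "continuous_on (sphere 0 1) g" and z: "norm z < 1"
  shows "Re (schwarz_integral g z) =
    integral {0..2*pi} (\<lambda>\<phi>. (1 - (norm z)\<^sup>2) / (norm (cis \<phi> - z))\<^sup>2 * g (cis \<phi>)) / (2*pi)"
proof -
  have int: "(\<lambda>\<phi>. (cis \<phi> + z) / (cis \<phi> - z) * of_real (g (cis \<phi>))) integrable_on cbox 0 (2*pi)"
    using cis_diff_nonzero[OF z]
    by (intro integrable_continuous continuous_intros continuous_on_circle_param[OF g]) auto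
  have "Re (integral (cbox 0 (2*pi)) (\<lambda>\<phi>. (cis \<phi> + z) / (cis \<phi> - z) * of_real (g (cis \<phi>)))) =
    integral (cbox 0 (2*pi)) (\<lambda>\<phi>. Re ((cis \<phi> + z) / (cis \<phi> - z) * of_real (g (cis \<phi>))))"
    using integral_linear[OF int bounded_linear_Re] by (simp add: o_def)
  also have "\<dots> = integral {0..2*pi} (\<lambda>\<phi>. (1 - (norm z)\<^sup>2) / (norm (cis \<phi> - z))\<^sup>2 * g (cis \<phi>))"
  proof -
    have "Re ((cis \<phi> + z) / (cis \<phi> - z) * of_real (g (cis \<phi>))) =
        (1 - (norm z)\<^sup>2) / (norm (cis \<phi> - z))\<^sup>2 * g (cis \<phi>)" for \<phi>
      unfolding Re_schwarz_kernel[OF z, symmetric] by (simp del: times_divide_eq_left times_divide_eq_right)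
    then show ?thesis by simp
  qed
  finally show ?thesis unfolding schwarz_integral_def
    by (metis Re_divide_of_real)
qed

lemma continuous_on_poisson_integrand:
  assumes "continuous_on (sphere 0 1) g" and "norm z < 1"
  shows "continuous_on S (\<lambda>\<phi>. (1 - (norm z)\<^sup>2) / (norm (cis \<phi> - z))\<^sup>2 * g (cis \<phi>))"
  using cis_diff_nonzero[OF assms(2)]
  by (intro continuous_intros continuous_on_circle_param[OF assms(1)]) auto

section \<open>Periodic integrands and arcs with arbitrary angles\<close>

lemma integral_translate:
  fixes F :: "real \<Rightarrow> real"
  assumes "continuous_on UNIV F"
  shows "integral {a + s..b + s} F = integral {a..b} (\<lambda>x. F (x + s))"
proof -
  have "(F has_integral integral {a + s..b + s} F) (cbox (a + s) (b + s))"
    using continuous_on_subset[OF assms] by (auto intro!: integrable_integral integrable_continuous_real)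
  from has_integral_affinity[OF this, of 1 s]
  have "((\<lambda>x. F (x + s)) has_integral integral {a + s..b + s} F) ((\<lambda>x. x - s) ` {a + s..b + s})"
    by simp
  moreover have "(\<lambda>x. x - s) ` {a + s..b + s} = {a..b}"
    by (simp add: image_diff_atLeastAtMost flip: diff_conv_add_uminus)
  ultimately show ?thesis by (simp add: integral_unique)
qed

lemma integral_period_shift_aux:
  fixes F :: "real \<Rightarrow> real"
  assumes F: "continuous_on UNIV F" and per: "\<And>x. F (x + 2*pi) = F x" and c: "0 \<le> c" "c \<le> 2*pi"
  shows "integral {c..c + 2*pi} F = integral {0..2*pi} F"
proof -
  have int: "F integrable_on {a..b}" for a b
    by (rule integrable_continuous_real) (rule continuous_on_subset[OF F], simp)
  have 1: "integral {0..c} F + integral {c..2*pi} F = integral {0..2*pi} F"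
    using c int by (intro Henstock_Kurzweil_Integration.integral_combine) auto
  have 2: "integral {c..2*pi} F + integral {2*pi..c + 2*pi} F = integral {c..c+2*pi} F"
    using c int by (intro Henstock_Kurzweil_Integration.integral_combine) auto
  show ?thesis using 1 2 per integral_translate[OF F, of 0 "2*pi" c] by simp
qed

text \<open>Arcs are located by \<open>Arg\<close> and may leave [0, 2 pi], the range of integration
  of \<open>schwarz_integral\<close>. Reducing c modulo 2 pi leads to the previous case, where a
  single cut at 2 pi suffices.\<close>

lemma integral_period_shift:
  fixes F :: "real \<Rightarrow> real"
  assumes F: "continuous_on UNIV F" and per: "\<And>x. F (x + 2*pi) = F x"
  shows "integral {c..c + 2*pi} F = integral {0..2*pi} F"
proof -
  define k where "k = \<lfloor>c / (2*pi)\<rfloor>"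
  define d where "d = c - of_int k * (2*pi)"
  have "0 \<le> frac (c / (2*pi))" "frac (c / (2*pi)) < 1" by (auto simp: frac_lt_1)
  moreover have "d = frac (c / (2*pi)) * (2*pi)"
    by (simp add: d_def k_def frac_def algebra_simps)
  ultimately have d: "0 \<le> d" "d \<le> 2*pi" by (auto simp: mult_le_cancel_right1)
  interpret periodic_fun_simple F "2*pi"
    by standard (rule per)
  have "integral {d..d + 2*pi} F = integral {c..c + 2*pi} F"
    using integral_translate[OF F, of d "of_int k * (2*pi)" "d + 2*pi"] plus_of_int[of _ k]
    by (simp add: d_def algebra_simps)
  with integral_period_shift_aux[OF F per d] show ?thesis by simp
qed

text \<open>The integrand is nonnegative, so only the arc from l to u is kept. There
  \<open>near\<close> bounds |\<zeta> - z|^2 by 2 (1 - |z|)^2, and the Poisson kernel is at least (1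
  + |z|) / (2 (1 - |z|)).\<close>

lemma Re_schwarz_integral_ge:
  assumes g: "continuous_on (sphere 0 1) g" and z: "norm z < 1"
    and nonneg: "\<And>\<zeta>. norm \<zeta> = 1 \<Longrightarrow> 0 \<le> g \<zeta>"
    and lu: "l \<le> u" "u \<le> l + 2*pi" and c: "0 \<le> c"
    and near: "\<And>\<phi>. l \<le> \<phi> \<Longrightarrow> \<phi> \<le> u \<Longrightarrow> norm (cis \<phi> - z) \<le> sqrt 2 * (1 - norm z)"
    and ge: "\<And>\<phi>. l \<le> \<phi> \<Longrightarrow> \<phi> \<le> u \<Longrightarrow> c \<le> g (cis \<phi>)"
  shows "c * ((1 + norm z) * (u - l) / (4 * pi * (1 - norm z))) \<le> Re (schwarz_integral g z)"
proof -
  let ?F = "\<lambda>\<phi>. (1 - (norm z)\<^sup>2) / (norm (cis \<phi> - z))\<^sup>2 * g (cis \<phi>)"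
  let ?m = "(1 + norm z) / (2 * (1 - norm z)) * c"
  have cont: "continuous_on S ?F" for S by (rule continuous_on_poisson_integrand[OF g z])
  have sq: "(norm z)\<^sup>2 \<le> 1" using z by (simp add: power_le_one)
  have F0: "0 \<le> ?F \<phi>" for \<phi>
    using nonneg[of "cis \<phi>"] sq by simp
  have Fm: "?m \<le> ?F \<phi>" if "l \<le> \<phi>" "\<phi> \<le> u" for \<phi>
  proof (rule mult_mono)
    have "0 < norm (cis \<phi> - z)" using cis_diff_nonzero[OF z] by simp
    moreover have "(norm (cis \<phi> - z))\<^sup>2 \<le> (sqrt 2 * (1 - norm z))\<^sup>2"
      using near[OF that] by (intro power_mono) auto
    then have "(norm (cis \<phi> - z))\<^sup>2 \<le> 2 * (1 - norm z)\<^sup>2" by (simp add: power_mult_distrib)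
    ultimately have "(1 - (norm z)\<^sup>2) / (2 * (1 - norm z)\<^sup>2) \<le> (1 - (norm z)\<^sup>2) / (norm (cis \<phi> - z))\<^sup>2"
      using sq z by (intro divide_left_mono mult_pos_pos) auto
    moreover have "1 - (norm z)\<^sup>2 = (1 + norm z) * (1 - norm z)"
      by (simp add: power2_eq_square algebra_simps)
    then have "(1 - (norm z)\<^sup>2) / (2 * (1 - norm z)\<^sup>2) = (1 + norm z) / (2 * (1 - norm z))"
      using z by (simp add: power2_eq_square)
    ultimately show "(1 + norm z) / (2 * (1 - norm z)) \<le> (1 - (norm z)\<^sup>2) / (norm (cis \<phi> - z))\<^sup>2" by simp
  qed (use ge[OF that] c sq in auto)
  have "?m * (u - l) = integral {l..u} (\<lambda>_. ?m)" using lu by simp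
  also have "\<dots> \<le> integral {l..u} ?F"
    using Fm by (intro integral_le integrable_continuous_real cont continuous_on_const) simp
  also have "\<dots> \<le> integral {l..l + 2*pi} ?F"
    using lu F0 by (intro integral_subset_le integrable_continuous_real cont) (simp_all only: atLeastatMost_subset_iff, simp_all)
  also have "\<dots> = integral {0..2*pi} ?F"
    by (rule integral_period_shift[OF cont]) (simp add: cis.ctr complex_eq_iff)
  finally have "?m * (u - l) / (2*pi) \<le> Re (schwarz_integral g z)"
    unfolding Re_schwarz_integral[OF g z] by (rule divide_right_mono) simp
  moreover have "?m * (u - l) / (2*pi) = c * ((1 + norm z) * (u - l) / (4 * pi * (1 - norm z)))"
    by (simp add: mult_ac)
  ultimately show ?thesis by simp
qed

section \<open>Chord geometry and an arc of harmonic measure at least 1/8\<close>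

lemma norm_cis_diff_squared:
  "(norm (cis a - of_real r * cis b))\<^sup>2 = (1 - r)\<^sup>2 + 4 * r * (sin ((a - b) / 2))\<^sup>2"
proof -
  have half: "2 * ((a - b) / 2) = a - b" by simp
  have "(norm (cis a - of_real r * cis b))\<^sup>2 =
     ((sin a)\<^sup>2 + (cos a)\<^sup>2) + r\<^sup>2 * ((sin b)\<^sup>2 + (cos b)\<^sup>2) - 2 * r * (cos a * cos b + sin a * sin b)"
    unfolding cmod_power2 by (simp add: power2_eq_square algebra_simps del: sin_cos_squared_add sin_cos_squared_add2 sin_cos_squared_add3)
  also have "\<dots> = 1 + r\<^sup>2 - 2 * r * cos (2 * ((a - b) / 2))"
    unfolding half by (simp add: cos_diff)
  also have "\<dots> = (1 - r)\<^sup>2 + 4 * r * (sin ((a - b) / 2))\<^sup>2"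
    unfolding cos_double_sin by (simp add: power2_eq_square algebra_simps)
  finally show ?thesis .
qed

text \<open>Mean value theorem with a decreasing derivative cos(x/2): it measures how much a chord
  shortens when one endpoint moves towards the other.\<close>

lemma sin_half_diff_ge:
  assumes "0 \<le> \<psi>" "\<psi> \<le> \<delta>" "\<delta> \<le> pi"
  shows "cos (\<delta>/2) * (\<delta> - \<psi>) \<le> 2 * sin (\<delta>/2) - 2 * sin (\<psi>/2)"
proof (cases "\<psi> = \<delta>")
  case False
  have "\<exists>\<xi>>\<psi>. \<xi> < \<delta> \<and> 2 * sin (\<delta>/2) - 2 * sin (\<psi>/2) = (\<delta> - \<psi>) * cos (\<xi>/2)"
    using False assms by (intro MVT2) (auto intro!: derivative_eq_intros)
  then obtain \<xi> where "\<psi> < \<xi>" "\<xi> < \<delta>" "2 * sin (\<delta>/2) - 2 * sin (\<psi>/2) = (\<delta> - \<psi>) * cos (\<xi>/2)"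
    by blast
  moreover have "cos (\<delta>/2) \<le> cos (\<xi>/2)"
    using assms \<open>\<psi> < \<xi>\<close> \<open>\<xi> < \<delta>\<close> by (intro cos_monotone_0_pi_le) auto
  ultimately show ?thesis using assms by (simp add: mult.commute mult_left_mono)
qed auto

text \<open>Think of e = 1, z = (1 - \<eta>) cis \<delta> and t = |z - e|. The chord S from e to the
  radial projection of z may exceed t, but by at most 0.099 \<eta>; moving its endpoint towards e by
  an angle \<eta>/10 shortens it by at least that much, since cos(\<delta>/2) \<ge> 0.99. This is
  why the arc stops \<eta>/10 short of the projection.\<close>

lemma sin_half_le_arc:
  assumes \<delta>: "0 \<le> \<delta>" "\<delta> \<le> pi" and \<eta>: "0 < \<eta>"
    and t: "0 < t" "t \<le> 1/45" "t\<^sup>2 = \<eta>\<^sup>2 + 4 * (1 - \<eta>) * (sin (\<delta>/2))\<^sup>2" "\<eta> \<le> t"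
    and \<psi>: "\<delta> - \<eta> \<le> \<psi>" "\<psi> \<le> \<delta> - \<eta>/10"
  shows "4 * (sin (\<psi>/2))\<^sup>2 \<le> t\<^sup>2"
proof -
  have "\<bar>2 * sin (\<psi>/2)\<bar> \<le> t"
  proof (cases "\<psi> \<le> 0")
    case True
    \<comment> \<open>On the far side of e the angle is at most \<eta> in modulus, and \<eta> \<le>
      t.\<close>
    have "\<bar>sin (\<psi>/2)\<bar> \<le> \<bar>\<psi>/2\<bar>" by (rule abs_sin_x_le_abs_x)
    then show ?thesis using True \<psi> \<delta> t by (simp add: abs_mult)
  next
    case False
    define S where "S = 2 * sin (\<delta>/2)"
    have S0: "0 \<le> S" unfolding S_def using \<delta> by (simp add: sin_ge_zero)
    have S: "t\<^sup>2 = \<eta>\<^sup>2 + (1 - \<eta>) * S\<^sup>2" using t(3) by (simp add: S_def power_mult_distrib)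
    have eta: "\<eta> \<le> 1/45" using t by simp
    have "(44/45) * S\<^sup>2 \<le> (1 - \<eta>) * S\<^sup>2" using eta by (intro mult_right_mono) auto
    moreover have "t\<^sup>2 \<le> 1/2025" using power_mono[of t "1/45" 2] t by (simp add: power_divide)
    ultimately have "S\<^sup>2 \<le> 1/1980" using S zero_le_power2[of \<eta>] by linarith
    moreover have "(cos (\<delta>/2))\<^sup>2 = 1 - S\<^sup>2/4" unfolding S_def by (simp add: cos_squared_eq)
    ultimately have "(99/100)\<^sup>2 \<le> (cos (\<delta>/2))\<^sup>2" by (simp add: power2_eq_square)
    moreover have "0 \<le> cos (\<delta>/2)" using \<delta> by (intro cos_ge_zero) auto
    ultimately have c: "99/100 \<le> cos (\<delta>/2)" by (rule power2_le_imp_le)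
    have "(99/100) * (\<eta>/10) \<le> cos (\<delta>/2) * (\<delta> - \<psi>)"
      using c \<psi> \<eta> by (intro mult_mono) auto
    also have "\<dots> \<le> S - 2 * sin (\<psi>/2)"
      unfolding S_def using False \<psi> \<delta> \<eta> by (intro sin_half_diff_ge) auto
    finally have 1: "2 * sin (\<psi>/2) \<le> S - 99/1000 * \<eta>" by simp
    \<comment> \<open>If S were larger, t^2 = \<eta>^2 + (1 - \<eta>) S^2 would force 0.198 (1 -
      \<eta>) t \<eta> + \<eta>^2 \<le> t^2 \<eta>, which is impossible for t \<le> 1/45.\<close>
    have "S \<le> t + 99/1000 * \<eta>"
    proof (rule ccontr)
      assume "\<not> S \<le> t + 99/1000 * \<eta>"
      then have "(t + 99/1000 * \<eta>)\<^sup>2 \<le> S\<^sup>2" using t \<eta> by (intro power_mono) auto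
      moreover have "t\<^sup>2 + 198/1000 * (t * \<eta>) \<le> (t + 99/1000 * \<eta>)\<^sup>2"
        by (simp add: power2_eq_square algebra_simps)
      ultimately have "(1 - \<eta>) * (t\<^sup>2 + 198/1000 * (t * \<eta>)) \<le> (1 - \<eta>) * S\<^sup>2"
        using eta by (intro mult_left_mono) auto
      then have "198/1000 * (1 - \<eta>) * (t * \<eta>) - t * (t * \<eta>) \<le> - (\<eta> * \<eta>)"
        using S by (simp add: power2_eq_square algebra_simps)
      moreover have "t * (t * \<eta>) \<le> (198/1000 * (1 - \<eta>)) * (t * \<eta>)"
        using t eta \<eta> by (intro mult_right_mono) auto
      moreover have "0 < \<eta> * \<eta>" using \<eta> by simp
      ultimately show False by linarith
    qed
    moreover have "0 \<le> sin (\<psi>/2)" using False \<psi> \<delta> \<eta> by (intro sin_ge_zero) auto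
    ultimately show ?thesis using 1 by simp
  qed
  then have "\<bar>2 * sin (\<psi>/2)\<bar>\<^sup>2 \<le> t\<^sup>2" by (rule power_mono) simp
  then show ?thesis by (simp add: power_mult_distrib)
qed

lemma sin_half_squared_le: "4 * (sin (x/2))\<^sup>2 \<le> x\<^sup>2" for x :: real
proof -
  have "(sin (x/2))\<^sup>2 \<le> (x/2)\<^sup>2"
    using abs_sin_x_le_abs_x[of "x/2"] by (simp only: abs_le_square_iff)
  then show ?thesis by (simp add: power_divide)
qed

text \<open>The radial and the angular part of the squared distance are each at most (1 - r)^2;
  hence the sqrt 2.\<close>

lemma norm_cis_near:
  assumes r: "0 \<le> r" "r < 1" and "\<bar>\<phi> - \<theta>\<bar> \<le> 1 - r"
  shows "norm (cis \<phi> - of_real r * cis \<theta>) \<le> sqrt 2 * (1 - r)"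
proof (rule power2_le_imp_le)
  have "4 * r * (sin ((\<phi> - \<theta>)/2))\<^sup>2 \<le> 1 * (4 * (sin ((\<phi> - \<theta>)/2))\<^sup>2)"
    unfolding mult.assoc mult.left_commute[of 4 r] using r by (intro mult_right_mono) auto
  also have "\<dots> \<le> (\<phi> - \<theta>)\<^sup>2" using sin_half_squared_le by simp
  also have "\<dots> \<le> (1 - r)\<^sup>2" using assms by (simp add: abs_le_square_iff[symmetric])
  finally show "(norm (cis \<phi> - of_real r * cis \<theta>))\<^sup>2 \<le> (sqrt 2 * (1 - r))\<^sup>2"
    unfolding norm_cis_diff_squared by (simp add: power_mult_distrib)
qed (use r in auto)

text \<open>With \<eta> = 1 - |z|, the arc lies on the side of z that faces e, at angles between
  \<eta>/10 and \<eta> from the radial projection of z. It is close enough to z for the Poisson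
  kernel to be of order 1/\<eta>, and far enough towards e for its chords not to exceed |z -
  e|.\<close>

lemma arc_towards_point:
  assumes e: "norm e = 1" and z: "norm z < 1" and t: "norm (z - e) \<le> 1/45"
  obtains l where "\<And>\<phi>. \<phi> \<in> {l..l + 9/10 * (1 - norm z)} \<Longrightarrow>
      norm (cis \<phi> - z) \<le> sqrt 2 * (1 - norm z) \<and> norm (cis \<phi> - e) \<le> norm (z - e)"
proof -
  define \<theta> \<delta> \<eta> where "\<theta> = Arg e" and "\<delta> = Arg (z / e)" and "\<eta> = 1 - norm z"
  have eta: "0 < \<eta>" using z by (simp add: \<eta>_def)
  have e_eq: "e = cis \<theta>"
    using e rcis_cmod_Arg[of e] by (simp add: \<theta>_def rcis_def)
  have "z / e = of_real (1 - \<eta>) * cis \<delta>"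
    using rcis_cmod_Arg[of "z / e"] e by (simp add: \<delta>_def \<eta>_def rcis_def norm_divide)
  then have z_eq: "z = of_real (1 - \<eta>) * cis (\<theta> + \<delta>)"
    by (simp add: e_eq divide_eq_eq mult_ac flip: cis_mult)
  have \<delta>: "-pi < \<delta>" "\<delta> \<le> pi" unfolding \<delta>_def using Arg_bounded by auto
  have ze: "(norm (z - e))\<^sup>2 = \<eta>\<^sup>2 + 4 * (1 - \<eta>) * (sin (\<bar>\<delta>\<bar>/2))\<^sup>2"
    unfolding norm_minus_commute[of z e] unfolding e_eq z_eq norm_cis_diff_squared
    by (cases "\<delta> \<ge> 0") (auto simp: abs_if)
  have \<eta>t: "\<eta> \<le> norm (z - e)"
    using e norm_triangle_ineq2[of e z] by (simp add: \<eta>_def norm_minus_commute)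
  have near: "norm (cis \<phi> - z) \<le> sqrt 2 * (1 - norm z)" if "\<bar>\<phi> - (\<theta> + \<delta>)\<bar> \<le> \<eta>" for \<phi>
    using norm_cis_near[of "1 - \<eta>" \<phi> "\<theta> + \<delta>", folded z_eq] that eta unfolding \<eta>_def by simp
  \<comment> \<open>Only |\<phi> - \<theta>| matters for the chord from e, so \<psi> will be \<phi>
    - \<theta> if z lies at a nonnegative angle from e, and \<theta> - \<phi> in the mirrored
    case.\<close>
  have ce: "norm (cis \<phi> - e) \<le> norm (z - e)"
    if "\<bar>\<delta>\<bar> - \<eta> \<le> \<psi>" "\<psi> \<le> \<bar>\<delta>\<bar> - \<eta>/10" "\<bar>\<phi> - \<theta>\<bar> = \<bar>\<psi>\<bar>" for \<phi> \<psi>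
  proof (rule power2_le_imp_le)
    have "4 * (sin (\<psi>/2))\<^sup>2 \<le> (norm (z - e))\<^sup>2"
      using that \<delta> eta \<eta>t t ze by (intro sin_half_le_arc[of "\<bar>\<delta>\<bar>" \<eta>]) auto
    moreover have "(norm (cis \<phi> - e))\<^sup>2 = 4 * (sin ((\<phi> - \<theta>)/2))\<^sup>2"
      using norm_cis_diff_squared[of \<phi> 1 \<theta>] by (simp add: e_eq)
    moreover have "(sin ((\<phi> - \<theta>)/2))\<^sup>2 = (sin (\<psi>/2))\<^sup>2"
    proof -
      have "\<phi> - \<theta> = \<psi> \<or> \<phi> - \<theta> = - \<psi>" using that(3) by linarith
      then show ?thesis by auto
    qed
    ultimately show "(norm (cis \<phi> - e))\<^sup>2 \<le> (norm (z - e))\<^sup>2" by simp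
  qed simp
  show thesis
  proof (cases "\<delta> \<ge> 0")
    case True
    show thesis
    proof (rule that[of "\<theta> + \<delta> - \<eta>"])
      fix \<phi> assume "\<phi> \<in> {\<theta> + \<delta> - \<eta>..\<theta> + \<delta> - \<eta> + 9/10 * (1 - norm z)}"
      then have "\<theta> + \<delta> - \<eta> \<le> \<phi>" "\<phi> \<le> \<theta> + \<delta> - \<eta>/10"
        by (auto simp: \<eta>_def field_simps)
      then show "norm (cis \<phi> - z) \<le> sqrt 2 * (1 - norm z) \<and> norm (cis \<phi> - e) \<le> norm (z - e)"
        using True eta by (intro conjI near ce[of "\<phi> - \<theta>" \<phi>]) linarith+
    qed
  next
    case False
    show thesis
    proof (rule that[of "\<theta> + \<delta> + \<eta>/10"])
      fix \<phi> assume "\<phi> \<in> {\<theta> + \<delta> + \<eta>/10..\<theta> + \<delta> + \<eta>/10 + 9/10 * (1 - norm z)}"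
      then have "\<theta> + \<delta> + \<eta>/10 \<le> \<phi>" "\<phi> \<le> \<theta> + \<delta> + \<eta>"
        by (auto simp: \<eta>_def field_simps)
      then show "norm (cis \<phi> - z) \<le> sqrt 2 * (1 - norm z) \<and> norm (cis \<phi> - e) \<le> norm (z - e)"
        using False eta by (intro conjI near ce[of "\<theta> - \<phi>" \<phi>]) linarith+
    qed
  qed
qed

text \<open>The harmonic measure of the arc \<open>{\<zeta>. \<bar>\<zeta> - e\<bar> \<le> \<bar>z - e\<bar>}\<close> seen from \<open>z\<close> close
  to \<open>e\<close> is at least \<open>1/8\<close>; this is what keeps the constants free of factors exponential in \<open>q\<close>.\<close>

lemma Re_schwarz_integral_ge_arc:
  assumes g: "continuous_on (sphere 0 1) g" and z: "norm z < 1"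
    and nonneg: "\<And>\<zeta>. norm \<zeta> = 1 \<Longrightarrow> 0 \<le> g \<zeta>"
    and e: "norm e = 1" and t: "norm (z - e) \<le> 1/45" and c: "0 \<le> c"
    and ge: "\<And>\<zeta>. norm \<zeta> = 1 \<Longrightarrow> norm (\<zeta> - e) \<le> norm (z - e) \<Longrightarrow>
               norm (\<zeta> - z) \<le> sqrt 2 * (1 - norm z) \<Longrightarrow> c \<le> g \<zeta>"
  shows "c / 8 \<le> Re (schwarz_integral g z)"
proof -
  obtain l where l: "\<And>\<phi>. \<phi> \<in> {l..l + 9/10 * (1 - norm z)} \<Longrightarrow>
      norm (cis \<phi> - z) \<le> sqrt 2 * (1 - norm z) \<and> norm (cis \<phi> - e) \<le> norm (z - e)"
    using arc_towards_point[OF e z t] by metis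
  have "1 - norm z \<le> norm (z - e)"
    using e norm_triangle_ineq2[of e z] by (simp add: norm_minus_commute)
  then have nz: "44/45 \<le> norm z" using t by simp
  \<comment> \<open>The arc has weight at least 89 / (200 pi), because |z| \<ge> 44/45; the rational
    bound 32/9 for pi is just sharp enough to leave 1/8.\<close>
  have "pi * 1 \<le> 32/9 * 1" using pi_approx(2) by simp
  then have "1/8 \<le> (1 + norm z) * (9/10) / (4 * pi)"
    using nz pi_gt_zero by (simp add: field_simps)
  then have "c * (1/8) \<le> c * ((1 + norm z) * (9/10) / (4 * pi))"
    using c by (rule mult_left_mono)
  also have "(1 + norm z) * (9/10) / (4 * pi) =
      (1 + norm z) * (l + 9/10 * (1 - norm z) - l) / (4 * pi * (1 - norm z))"
    using z by (simp only: add_diff_cancel_left' mult.assoc[symmetric]) simp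
  also have "c * \<dots> \<le> Re (schwarz_integral g z)"
  proof (rule Re_schwarz_integral_ge[OF g z nonneg _ _ c])
    show "l + 9/10 * (1 - norm z) \<le> l + 2*pi" using pi_gt3 norm_ge_zero[of z] unfolding right_diff_distrib by linarith
  qed (use z l ge in auto)
  finally show ?thesis by simp
qed

section \<open>Corrected Blaschke factors\<close>

text \<open>Jordan's inequality: a concave function lies above its chord.\<close>

lemma sin_ge_two_pi:
  assumes "0 \<le> x" "x \<le> pi/2"
  shows "2 * x / pi \<le> sin x"
proof -
  have "convex_on {0..pi/2} (\<lambda>x. - sin x)"
    by (rule f''_ge0_imp_convex[where f' = "\<lambda>x. - cos x" and f'' = sin])
       (auto intro!: derivative_eq_intros sin_ge_zero)
  from convex_onD[OF this, of "2 * x / pi" 0 "pi/2"] show ?thesis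
    using assms by (simp add: field_simps)
qed

lemma norm_cis_diff_ge:
  assumes r: "0 \<le> r" and \<phi>: "\<bar>\<phi> - \<theta>\<bar> \<le> pi"
  shows "\<bar>\<phi> - \<theta>\<bar> / pi \<le> norm (cis \<phi> - of_real r * cis \<theta>)"
proof (rule power2_le_imp_le)
  define s where "s = (sin ((\<phi> - \<theta>)/2))\<^sup>2"
  have s: "0 \<le> s" "s \<le> 1" by (auto simp: s_def abs_square_le_1)
  have "\<bar>\<phi> - \<theta>\<bar> / pi \<le> sin (\<bar>\<phi> - \<theta>\<bar> / 2)"
    using sin_ge_two_pi[of "\<bar>\<phi> - \<theta>\<bar> / 2"] \<phi> by simp
  then have "(\<bar>\<phi> - \<theta>\<bar> / pi)\<^sup>2 \<le> (sin (\<bar>\<phi> - \<theta>\<bar> / 2))\<^sup>2"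
    by (rule power_mono) simp
  also have "\<dots> = s"
  proof (cases "\<phi> \<ge> \<theta>")
    case False
    then have "\<bar>\<phi> - \<theta>\<bar> / 2 = - ((\<phi> - \<theta>) / 2)" by (simp add: field_simps)
    then show ?thesis unfolding s_def by (simp only: sin_minus power2_minus)
  qed (simp add: s_def)
  \<comment> \<open>The squared distance is the convex combination (1 - s) (1 - r)^2 + s (1 + r)^2,
    which is at least s for every r \<ge> 0.\<close>
  also have "s \<le> (1 - s) * (1 - r)\<^sup>2 + s * (r\<^sup>2 + 2 * r) + s"
    using s r by simp
  also have "\<dots> = (1 - r)\<^sup>2 + 4 * r * s" by (simp add: power2_eq_square algebra_simps)
  finally show "(\<bar>\<phi> - \<theta>\<bar> / pi)\<^sup>2 \<le> (norm (cis \<phi> - of_real r * cis \<theta>))\<^sup>2"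
    unfolding norm_cis_diff_squared s_def .
qed simp

definition blaschke :: "complex \<Rightarrow> complex \<Rightarrow> complex" where
  "blaschke a z = (z - a) / (1 - cnj a * z)"

lemma blaschke_denom_ge:
  assumes "norm a < 1" "norm z \<le> 1"
  shows "1 - norm a \<le> norm (1 - cnj a * z)"
proof -
  have "norm a * norm z \<le> norm a * 1" using assms by (intro mult_left_mono) auto
  then show ?thesis using norm_triangle_ineq2[of 1 "cnj a * z"] by (simp add: norm_mult)
qed

lemma blaschke_denom_nonzero:
  "norm a < 1 \<Longrightarrow> norm z \<le> 1 \<Longrightarrow> 1 - cnj a * z \<noteq> 0"
  using blaschke_denom_ge[of a z] by auto

lemma blaschke_numerator: "(norm (z - a))\<^sup>2 = (norm (1 - cnj a * z))\<^sup>2 - (1 - (norm a)\<^sup>2) * (1 - (norm z)\<^sup>2)"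
  unfolding cmod_power2 by (simp add: power2_eq_square algebra_simps)

lemma norm_blaschke_squared:
  assumes "norm a < 1" "norm z \<le> 1"
  shows "(norm (blaschke a z))\<^sup>2 = 1 - (1 - (norm a)\<^sup>2) * (1 - (norm z)\<^sup>2) / (norm (1 - cnj a * z))\<^sup>2"
  using blaschke_denom_nonzero[OF assms] blaschke_numerator[of z a]
  unfolding blaschke_def norm_divide power_divide by (simp add: diff_divide_distrib)

section \<open>Distance to E, and Blaschke factors corrected near E\<close>

locale closed_circle_set =
  fixes E :: "complex set"
  assumes closed: "closed E" and sub: "E \<subseteq> sphere 0 1" and ne: "E \<noteq> {}"
begin

lemma infdist_attained: obtains e where "e \<in> E" "norm e = 1" "infdist z E = norm (z - e)"
proof -
  obtain e where "e \<in> E" "infdist z E = dist z e" using infdist_attains_inf[OF closed ne] .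
  then show thesis using that[of e] sub by (auto simp: dist_norm)
qed

lemma infdist_le_2: "norm z \<le> 1 \<Longrightarrow> infdist z E \<le> 2"
proof (rule infdist_attained[of z])
  fix e assume "norm z \<le> 1" "norm e = 1" "infdist z E = norm (z - e)"
  then show ?thesis using norm_triangle_ineq4[of z e] by simp
qed

lemma infdist_ge: "1 - norm z \<le> infdist z E"
proof (rule infdist_attained[of z])
  fix e assume "norm e = 1" "infdist z E = norm (z - e)"
  then show ?thesis using norm_triangle_ineq2[of e z] by (simp add: norm_minus_commute)
qed

lemma infdist_pos: "norm z < 1 \<Longrightarrow> 0 < infdist z E"
  using infdist_ge[of z] by simp

text \<open>The boundary values of the harmonic majorant of \<open>log (1 / \<bar>blaschke a\<bar>)\<close> on
  \<open>{z. infdist z E = t}\<close>, up to a constant the Poisson kernel of \<open>a\<close>, cut off near \<open>E\<close>.\<close>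

definition correction :: "real \<Rightarrow> complex \<Rightarrow> complex \<Rightarrow> real" where
  "correction t a \<zeta> = 9 * t * ((1 - (norm a)\<^sup>2) / (norm (\<zeta> - a))\<^sup>2) * max 0 (min 1 (2 - infdist \<zeta> E / t))"

lemma continuous_on_correction:
  assumes "norm a < 1" "0 < t"
  shows "continuous_on (sphere 0 1) (correction t a)"
  unfolding correction_def using assms
  by (intro continuous_intros) auto

lemma correction_nonneg: "norm a < 1 \<Longrightarrow> 0 < t \<Longrightarrow> 0 \<le> correction t a \<zeta>"
  unfolding correction_def by (intro mult_nonneg_nonneg divide_nonneg_nonneg) (auto simp: power_le_one)

lemma Re_schwarz_integral_nonneg:
  assumes "continuous_on (sphere 0 1) g" "norm z < 1" "\<And>\<zeta>. norm \<zeta> = 1 \<Longrightarrow> 0 \<le> g \<zeta>"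
  shows "0 \<le> Re (schwarz_integral g z)"
  unfolding Re_schwarz_integral[OF assms(1,2)] using assms(2,3)
  by (intro divide_nonneg_nonneg integral_nonneg integrable_continuous_real
      continuous_on_poisson_integrand[OF assms(1,2)] mult_nonneg_nonneg) (auto simp: power_le_one)

text \<open>|B_a(z)|^2 = 1 - x with x \<le> 2 t Q, where Q = (1 - |a|^2) / |1 - \<open>cnj a\<close>
  z|^2. On the arc near z the cutoff equals 1 and the Poisson kernel of a is at least 19/20 Q, so
  the correction contributes at least 9 (19/20) t Q / 8 to the exponent. It remains to beat 1 - x by
  an exponential, with x small because a is far from z relative to t.\<close>

lemma one_le_corrected_blaschke:
  assumes a: "norm a < 1" "90 * t \<le> infdist a E" and t: "0 < t" and z: "norm z < 1" "infdist z E = t"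
  shows "1 \<le> norm (blaschke a z) * exp (Re (schwarz_integral (correction t a) z))"
proof -
  obtain e where e: "e \<in> E" "norm e = 1" "infdist z E = norm (z - e)"
    by (rule infdist_attained)
  have t2: "t \<le> 1/45" using a infdist_le_2[of a] by simp
  define d where "d = norm (1 - cnj a * z)"
  define Q where "Q = (1 - (norm a)\<^sup>2) / d\<^sup>2"
  define k where "k = Re (schwarz_integral (correction t a) z)"
  define x where "x = Q * (1 - (norm z)\<^sup>2)"
  have d_ge: "1 - norm a \<le> d" unfolding d_def using a z by (intro blaschke_denom_ge) auto
  have d0: "0 < d" using d_ge a by simp
  have sqa: "(norm a)\<^sup>2 \<le> 1" and sqz: "(norm z)\<^sup>2 \<le> 1" using a z by (auto simp: power_le_one)
  have Q0: "0 \<le> Q" unfolding Q_def using sqa by simp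
  have za: "89 * t \<le> norm (z - a)"
    using infdist_triangle[of a E z] a z by (simp add: dist_norm norm_minus_commute)
  have "(norm (z - a))\<^sup>2 \<le> d\<^sup>2"
    unfolding d_def blaschke_numerator[of z a] using sqa sqz by simp
  then have "norm (z - a) \<le> d" by (rule power2_le_imp_le) (use d0 in simp)
  then have d89: "89 * t \<le> d" using za by simp
  have one_z: "1 - norm z \<le> t" using infdist_ge[of z] z by simp
  have zt: "1 - (norm z)\<^sup>2 \<le> 2 * t"
  proof -
    have "1 - (norm z)\<^sup>2 = (1 - norm z) * (1 + norm z)" by (simp add: power2_eq_square algebra_simps)
    also have "\<dots> \<le> t * 2" using one_z z by (intro mult_mono) auto
    finally show ?thesis by simp
  qed
  have Qd: "Q * d \<le> 2"
  proof -
    have "1 - (norm a)\<^sup>2 = (1 - norm a) * (1 + norm a)" by (simp add: power2_eq_square algebra_simps)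
    also have "\<dots> \<le> d * 2" using d_ge a by (intro mult_mono) auto
    finally have "(1 - (norm a)\<^sup>2) / d \<le> 2" using d0 by (simp add: divide_le_eq mult.commute)
    then show ?thesis using d0 by (simp add: Q_def power2_eq_square)
  qed
  have x0: "0 \<le> x" unfolding x_def using Q0 sqz by simp
  have xQ: "x \<le> 2 * (t * Q)"
    unfolding x_def using mult_left_mono[OF zt Q0] by (simp add: mult_ac)
  have tQ: "89 * (t * Q) \<le> 2" using mult_right_mono[OF d89 Q0] Qd by (simp add: mult_ac)
  have x_small: "x \<le> 1/20" using xQ tQ by simp
  have "(9 * (19/20) * (t * Q)) / 8 \<le> k"
    unfolding k_def
  proof (rule Re_schwarz_integral_ge_arc)
    show "continuous_on (sphere 0 1) (correction t a)"
      using a(1) t by (rule continuous_on_correction)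
    show "norm (z - e) \<le> 1/45" using e z t2 by simp
    fix \<zeta> :: complex
    assume \<zeta>: "norm \<zeta> = 1" "norm (\<zeta> - e) \<le> norm (z - e)" "norm (\<zeta> - z) \<le> sqrt 2 * (1 - norm z)"
    have "infdist \<zeta> E \<le> t"
      using infdist_le2[OF e(1), of \<zeta> t] \<zeta>(2) e z by (simp add: dist_norm)
    then have "max 0 (min 1 (2 - infdist \<zeta> E / t)) = 1" using t by simp
    then have corr: "correction t a \<zeta> = 9 * t * ((1 - (norm a)\<^sup>2) / (norm (\<zeta> - a))\<^sup>2)"
      by (simp add: correction_def)
    have \<zeta>a: "norm (\<zeta> - a) = norm (1 - cnj a * \<zeta>)"
    proof (rule power2_eq_imp_eq)
      show "(norm (\<zeta> - a))\<^sup>2 = (norm (1 - cnj a * \<zeta>))\<^sup>2"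
        unfolding blaschke_numerator[of \<zeta> a] \<zeta>(1) by simp
    qed simp_all
    have \<zeta>z: "norm (\<zeta> - z) \<le> 2 * t"
    proof -
      have "sqrt 2 * (1 - norm z) \<le> 2 * t"
        using one_z z sqrt2_less_2 t by (intro mult_mono) auto
      then show ?thesis using \<zeta>(3) by simp
    qed
    have "1 - cnj a * \<zeta> = (1 - cnj a * z) - cnj a * (\<zeta> - z)" by (simp add: algebra_simps)
    then have "norm (\<zeta> - a) \<le> d + norm (cnj a * (\<zeta> - z))"
      unfolding \<zeta>a d_def by (metis norm_triangle_ineq4)
    also have "norm (cnj a * (\<zeta> - z)) \<le> 1 * (2 * t)"
      unfolding norm_mult using a \<zeta>z by (intro mult_mono) auto
    \<comment> \<open>The displacement 2 t is at most 2/89 of d, and (91/89)^2 < 20/19; this is the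
      loss 19/20 in the bound for the kernel.\<close>
    finally have "norm (\<zeta> - a) \<le> 91/89 * d" using d89 by simp
    then have "(norm (\<zeta> - a))\<^sup>2 \<le> (91/89 * d)\<^sup>2" by (rule power_mono) simp
    also have "\<dots> \<le> 20/19 * d\<^sup>2" by (simp add: power_mult_distrib power_divide)
    finally have le: "(norm (\<zeta> - a))\<^sup>2 \<le> 20/19 * d\<^sup>2" .
    have "\<zeta> \<noteq> a" using \<zeta>(1) a by auto
    then have "(1 - (norm a)\<^sup>2) / (20/19 * d\<^sup>2) \<le> (1 - (norm a)\<^sup>2) / (norm (\<zeta> - a))\<^sup>2"
      using le sqa d0 by (intro divide_left_mono mult_pos_pos) auto
    then have "19/20 * Q \<le> (1 - (norm a)\<^sup>2) / (norm (\<zeta> - a))\<^sup>2"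
      by (simp add: Q_def right_diff_distrib diff_divide_distrib)
    then have "9 * t * (19/20 * Q) \<le> correction t a \<zeta>"
      unfolding corr using t by (intro mult_left_mono) auto
    then show "9 * (19/20) * (t * Q) \<le> correction t a \<zeta>" by (simp add: mult_ac)
  qed (use z e a t correction_nonneg Q0 in auto)
  then have "17/16 * x \<le> 2 * k" using xQ mult_nonneg_nonneg[OF less_imp_le[OF t] Q0] by simp
  \<comment> \<open>9 (19/20) / 8 = 171/160 exceeds 17/16, and the surplus x/16 pays for the
    quadratic term as x \<le> 1/20.\<close>
  moreover have "1 \<le> (1 - x) * (1 + 17/16 * x)"
  proof -
    have "x * x \<le> x * (1/20)" using x_small x0 by (rule mult_left_mono)
    moreover have "(1 - x) * (1 + 17/16 * x) = 1 + 1/16 * x - 17/16 * (x * x)" by (simp add: field_simps)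
    ultimately show ?thesis using x0 by linarith
  qed
  moreover have "(1 - x) * (1 + 17/16 * x) \<le> (1 - x) * (1 + 2 * k)"
    using x_small \<open>17/16 * x \<le> 2 * k\<close> by (intro mult_left_mono) auto
  moreover have "(1 - x) * (1 + 2 * k) \<le> (1 - x) * exp (2 * k)"
    using x_small by (intro mult_left_mono exp_ge_add_one_self) auto
  ultimately have "1 \<le> (1 - x) * exp (2 * k)" by linarith
  also have "1 - x = (norm (blaschke a z))\<^sup>2"
    using norm_blaschke_squared[of a z] a z by (simp add: x_def Q_def d_def)
  also have "(norm (blaschke a z))\<^sup>2 * exp (2 * k) = (norm (blaschke a z) * exp k)\<^sup>2"
    by (simp add: power_mult_distrib exp_double)
  finally have "1\<^sup>2 \<le> (norm (blaschke a z) * exp k)\<^sup>2" by simp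
  then have "1 \<le> norm (blaschke a z) * exp k" by (rule power2_le_imp_le) simp
  then show ?thesis by (simp add: k_def)
qed

text \<open>The correction vanishes unless rho < 2 t, and then |\<zeta> - a| \<ge> 90 t - 2 t.
  Together with the angular lower bound this dominates the kernel by a Cauchy density of width
  proportional to R = 88 t, with integral of order (1 - |a|^2) / R. The factor t cancels and a small
  multiple of 1 - |a| remains.\<close>

lemma Re_schwarz_integral_correction_0:
  assumes a: "norm a < 1" "90 * t \<le> infdist a E" and t: "0 < t"
  shows "Re (schwarz_integral (correction t a) 0) \<le> 2/3 * (1 - norm a)"
proof -
  define \<theta> R b where "\<theta> = Arg a" and "R = 88 * t" and "b = 1 - (norm a)\<^sup>2"
  have a_eq: "a = of_real (norm a) * cis \<theta>"
    using rcis_cmod_Arg[of a] by (simp add: \<theta>_def rcis_def)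
  have R: "0 < R" using t by (simp add: R_def)
  have b: "0 \<le> b" using a by (simp add: b_def power_le_one)
  note cont = continuous_on_circle_param[OF continuous_on_correction[OF a(1) t]]
  let ?G = "\<lambda>\<phi>. 18 * t * b * (1 / (R\<^sup>2 + ((\<phi> - \<theta>) / pi)\<^sup>2))"
  have pt: "correction t a (cis \<phi>) \<le> ?G \<phi>" if \<phi>: "\<phi> \<in> {\<theta> - pi..\<theta> + pi}" for \<phi>
  proof (cases "infdist (cis \<phi>) E < 2 * t")
    case True
    have "R \<le> norm (cis \<phi> - a)"
      using infdist_triangle[of a E "cis \<phi>"] a True by (simp add: dist_norm norm_minus_commute R_def)
    then have "R\<^sup>2 \<le> (norm (cis \<phi> - a))\<^sup>2" using R by (intro power_mono) auto
    moreover have "\<bar>\<phi> - \<theta>\<bar> / pi \<le> norm (cis \<phi> - a)"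
      using norm_cis_diff_ge[of "norm a" \<phi> \<theta>] \<phi> a_eq by auto
    then have "(\<bar>\<phi> - \<theta>\<bar> / pi)\<^sup>2 \<le> (norm (cis \<phi> - a))\<^sup>2" by (rule power_mono) simp
    then have "((\<phi> - \<theta>) / pi)\<^sup>2 \<le> (norm (cis \<phi> - a))\<^sup>2" by (simp add: power_divide)
    \<comment> \<open>The average of the two lower bounds replaces their maximum, so that the
      dominating function has an arctan as antiderivative.\<close>
    ultimately have le: "(R\<^sup>2 + ((\<phi> - \<theta>) / pi)\<^sup>2) / 2 \<le> (norm (cis \<phi> - a))\<^sup>2" by simp
    have pos: "0 < R\<^sup>2 + ((\<phi> - \<theta>) / pi)\<^sup>2" using R by (intro add_pos_nonneg) auto
    have le_b: "b / (norm (cis \<phi> - a))\<^sup>2 \<le> b / ((R\<^sup>2 + ((\<phi> - \<theta>) / pi)\<^sup>2) / 2)"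
      using le pos b cis_diff_nonzero[OF a(1)] by (intro divide_left_mono mult_pos_pos) auto
    have "correction t a (cis \<phi>) \<le> 9 * t * (b / (norm (cis \<phi> - a))\<^sup>2) * 1"
      unfolding correction_def b_def[symmetric] using t b by (intro mult_left_mono) auto
    moreover have "\<dots> \<le> 9 * t * (b / ((R\<^sup>2 + ((\<phi> - \<theta>) / pi)\<^sup>2) / 2))"
      using mult_left_mono[OF le_b, of "9 * t"] t by simp
    ultimately have "correction t a (cis \<phi>) \<le> 9 * t * (b / ((R\<^sup>2 + ((\<phi> - \<theta>) / pi)\<^sup>2) / 2))"
      by simp
    then show ?thesis by (simp add: mult_ac)
  next
    case False
    then have "2 - infdist (cis \<phi>) E / t \<le> 0" using t by (simp add: field_simps)
    then have "correction t a (cis \<phi>) = 0" by (simp add: correction_def)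
    then show ?thesis using t b by simp
  qed
  have G: "(?G has_integral (18 * t * b * (pi / R * arctan (1 / R)) - 18 * t * b * (pi / R * arctan (- 1 / R))))
     {\<theta> - pi..\<theta> + pi}"
  proof -
    have "(?G has_integral (18 * t * b * (pi / R * arctan ((\<theta> + pi - \<theta>) / (pi * R))) -
        18 * t * b * (pi / R * arctan ((\<theta> - pi - \<theta>) / (pi * R))))) {\<theta> - pi..\<theta> + pi}"
    proof (rule fundamental_theorem_of_calculus)
      fix \<phi> :: real
      have pos: "0 < R\<^sup>2 + ((\<phi> - \<theta>) / pi)\<^sup>2" using R by (intro add_pos_nonneg) auto
      have eq: "pi / R * (1 / (pi * R) / (1 + ((\<phi> - \<theta>) / (pi * R))\<^sup>2)) = 1 / (R\<^sup>2 + ((\<phi> - \<theta>) / pi)\<^sup>2)"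
      proof -
        have "R\<^sup>2 * (1 + ((\<phi> - \<theta>) / (pi * R))\<^sup>2) = R\<^sup>2 + ((\<phi> - \<theta>) / pi)\<^sup>2"
          using R by (simp add: power_divide power_mult_distrib distrib_left)
        moreover have "pi / R * (1 / (pi * R) / (1 + ((\<phi> - \<theta>) / (pi * R))\<^sup>2)) =
            1 / (R\<^sup>2 * (1 + ((\<phi> - \<theta>) / (pi * R))\<^sup>2))"
          using R by (simp add: power2_eq_square)
        ultimately show ?thesis by simp
      qed
      have "((\<lambda>\<phi>. 18 * t * b * (pi / R * arctan ((\<phi> - \<theta>) / (pi * R)))) has_real_derivative
         18 * t * b * (pi / R * (1 / (pi * R) / (1 + ((\<phi> - \<theta>) / (pi * R))\<^sup>2)))) (at \<phi> within {\<theta> - pi..\<theta> + pi})"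
        by (auto intro!: derivative_eq_intros simp: divide_inverse)
      then show "((\<lambda>\<phi>. 18 * t * b * (pi / R * arctan ((\<phi> - \<theta>) / (pi * R)))) has_vector_derivative ?G \<phi>)
          (at \<phi> within {\<theta> - pi..\<theta> + pi})"
        unfolding eq by (simp only: has_real_derivative_iff_has_vector_derivative)
    qed simp
    then show ?thesis using R by simp
  qed
  have "integral {0..2*pi} (\<lambda>\<phi>. correction t a (cis \<phi>)) =
      integral {\<theta> - pi..\<theta> - pi + 2*pi} (\<lambda>\<phi>. correction t a (cis \<phi>))"
    by (rule integral_period_shift[symmetric, OF cont]) (simp add: cis.ctr complex_eq_iff)
  also have "\<dots> \<le> integral {\<theta> - pi..\<theta> + pi} ?G"
  proof -
    have "\<theta> - pi + 2*pi = \<theta> + pi" by simp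
    then show ?thesis using pt G
      by (simp only:) (intro integral_le integrable_continuous_real cont has_integral_integrable[OF G], blast)
  qed
  also have "\<dots> = 36 * t * b * (pi / R) * arctan (1 / R)"
    using integral_unique[OF G] by (simp add: arctan_minus)
  also have "\<dots> \<le> 36 * t * b * (pi / R) * (pi / 2)"
    using t b R arctan_ubound[of "1/R"] by (intro mult_left_mono) auto
  finally have "integral {0..2*pi} (\<lambda>\<phi>. correction t a (cis \<phi>)) / (2*pi) \<le> 36 * t * b * (pi / R) * (pi / 2) / (2*pi)"
    by (rule divide_right_mono) simp
  also have "\<dots> = 9/88 * pi * b" using t by (simp add: R_def)
  \<comment> \<open>88/27 is a bound for pi that makes the product exactly 1/3.\<close>
  also have "\<dots> \<le> 9/88 * (88/27) * b" using pi_approx(2) b by (intro mult_right_mono) auto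
  also have "\<dots> = 1/3 * ((1 - norm a) * (1 + norm a))" by (simp add: b_def power2_eq_square algebra_simps)
  also have "\<dots> \<le> 1/3 * ((1 - norm a) * 2)" using a by (intro mult_left_mono) auto
  finally have "integral {0..2*pi} (\<lambda>\<phi>. correction t a (cis \<phi>)) / (2*pi) \<le> 2/3 * (1 - norm a)" by simp
  then show ?thesis
    using Re_schwarz_integral[OF continuous_on_correction[OF a(1) t], of 0] by simp
qed

end

section \<open>The sum over the zeros away from \<open>E\<close>\<close>

text \<open>Away from a the removed power of z - a does not vanish, so the other multiplicities
  survive. Recording this is what allows zeros to be removed one after the other by
  induction.\<close>

lemma factor_out_zero:
  assumes f: "f holomorphic_on S" and S: "open S" "connected S" "a \<in> S" and nz: "\<exists>w\<in>S. f w \<noteq> 0"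
  obtains g where "g holomorphic_on S" "g a \<noteq> 0"
    "\<And>z. z \<in> S \<Longrightarrow> f z = (z - a) ^ nat (zorder f a) * g z"
    "\<And>b. b \<in> S \<Longrightarrow> b \<noteq> a \<Longrightarrow> zorder g b = zorder f b"
proof -
  define n where "n = nat (zorder f a)"
  define h where "h = zor_poly f a"
  obtain r where r: "0 < r" "cball a r \<subseteq> S" "h holomorphic_on cball a r"
    and h: "\<And>w. w \<in> cball a r \<Longrightarrow> f w = h w * (w - a) ^ n \<and> h w \<noteq> 0"
    using zorder_exist_zero[OF f S nz] unfolding n_def h_def by blast
  define g where "g z = (if z = a then h a else f z / (z - a) ^ n)" for z
  have gh: "g z = h z" if "z \<in> cball a r" for z
    using h[OF that] by (simp add: g_def)
  have fg: "f z = (z - a) ^ n * g z" if "z \<in> S" for z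
    using h[of a] r(1) by (cases "z = a") (simp_all add: g_def power_0_left)
  have "g holomorphic_on (S - {a}) \<union> ball a r"
  proof (rule holomorphic_on_Un)
    have "(\<lambda>z. f z / (z - a) ^ n) holomorphic_on S - {a}"
      by (intro holomorphic_intros holomorphic_on_subset[OF f]) auto
    then show "g holomorphic_on S - {a}"
      by (rule holomorphic_transform) (auto simp: g_def)
    have "h holomorphic_on ball a r" using r(3) by (rule holomorphic_on_subset) auto
    then show "g holomorphic_on ball a r"
      by (rule holomorphic_transform) (simp add: gh)
  qed (use S in \<open>auto intro: open_delete\<close>)
  then have hol: "g holomorphic_on S"
    by (rule holomorphic_on_subset) (use r in auto)
  have ga: "g a \<noteq> 0" using h[of a] r(1) by (simp add: g_def)
  have "zorder g b = zorder f b" if b: "b \<in> S" "b \<noteq> a" for b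
  proof -
    define k where "k = zor_poly g b"
    have "\<exists>w\<in>S. g w \<noteq> 0" using ga S(3) by blast
    from zorder_exist_zero[OF hol S(1,2) b(1) this] obtain s where s: "0 < s" "cball b s \<subseteq> S"
      "k holomorphic_on cball b s" "\<And>w. w \<in> cball b s \<Longrightarrow> g w = k w * (w - b) ^ nat (zorder g b) \<and> k w \<noteq> 0"
      and pos: "0 \<le> zorder g b"
      unfolding k_def by (metis (no_types, lifting) less_imp_le order_refl)
    have "zorder f b = zorder g b"
    proof (rule zorder_eqI)
      show "(\<lambda>w. (w - a) ^ n * k w) holomorphic_on ball b s"
        by (intro holomorphic_intros holomorphic_on_subset[OF s(3)]) auto
      show "(b - a) ^ n * k b \<noteq> 0" using b s(1) s(4)[of b] by auto
      fix w assume "w \<in> ball b s"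
      then have w: "w \<in> cball b s" by auto
      then show "f w = (w - a) ^ n * k w * (w - b) powi zorder g b"
        using fg[of w] s(2) s(4)[OF w] pos by (auto simp: power_int_def)
    qed (use s(1) in auto)
    then show ?thesis by simp
  qed
  with hol ga fg show thesis unfolding n_def by (rule that)
qed

lemma factor_out_zeros:
  assumes "finite A" "A \<subseteq> S" "open S" "connected S" "f holomorphic_on S" "\<exists>w\<in>S. f w \<noteq> 0"
  shows "\<exists>g. g holomorphic_on S \<and> (\<forall>z\<in>S. f z = g z * (\<Prod>a\<in>A. (z - a) ^ nat (zorder f a)))"
  using assms
proof (induction A arbitrary: f rule: finite_induct)
  case empty
  then show ?case by auto
next
  case (insert a A)
  then have a: "a \<in> S" by auto
  obtain g where g: "g holomorphic_on S" "g a \<noteq> 0"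
    "\<And>z. z \<in> S \<Longrightarrow> f z = (z - a) ^ nat (zorder f a) * g z"
    "\<And>b. b \<in> S \<Longrightarrow> b \<noteq> a \<Longrightarrow> zorder g b = zorder f b"
    using factor_out_zero[OF insert.prems(4,2,3) a insert.prems(5)] by blast
  obtain k where k: "k holomorphic_on S"
    "\<And>z. z \<in> S \<Longrightarrow> g z = k z * (\<Prod>b\<in>A. (z - b) ^ nat (zorder g b))"
    using insert.IH[OF _ insert.prems(2,3) g(1)] insert.prems(1) a g(2) by blast
  have "(\<Prod>b\<in>A. (z - b) ^ nat (zorder g b)) = (\<Prod>b\<in>A. (z - b) ^ nat (zorder f b))" for z
  proof (rule prod.cong)
    fix b assume "b \<in> A"
    then have "b \<in> S" "b \<noteq> a" using insert by auto
    then show "(z - b) ^ nat (zorder g b) = (z - b) ^ nat (zorder f b)" using g(4) by simp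
  qed simp
  then show ?case using k g(3) insert.hyps by (intro exI[of _ k]) (auto simp: mult_ac)
qed

section \<open>The harmonic majorant of rho^(-q)\<close>

context closed_circle_set
begin

definition majorant :: "real \<Rightarrow> real \<Rightarrow> complex \<Rightarrow> real" where
  "majorant q t \<zeta> = max t (infdist \<zeta> E) powr (-q)"

lemma continuous_on_majorant: "0 < t \<Longrightarrow> continuous_on S (majorant q t)"
  unfolding majorant_def by (intro continuous_intros) (auto simp: max_def)

lemma majorant_nonneg [simp]: "0 \<le> majorant q t \<zeta>"
  by (simp add: majorant_def)

text \<open>With the nearest point e of E as centre, the whole arc satisfies rho \<le> t, where the
  truncated power equals t^(-q) exactly.\<close>

lemma majorant_bound_inner:
  assumes t: "0 < t" "t \<le> 1/45" and z: "norm z < 1" "infdist z E = t"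
  shows "infdist z E powr (-q) \<le> 8 * Re (schwarz_integral (majorant q t) z)"
proof -
  obtain e where e: "e \<in> E" "norm e = 1" "infdist z E = norm (z - e)"
    by (rule infdist_attained)
  have "t powr (-q) / 8 \<le> Re (schwarz_integral (majorant q t) z)"
  proof (rule Re_schwarz_integral_ge_arc)
    fix \<zeta> :: complex
    assume \<zeta>: "norm (\<zeta> - e) \<le> norm (z - e)"
    have "infdist \<zeta> E \<le> t"
      using infdist_le2[OF e(1), of \<zeta> t] \<zeta> e z by (simp add: dist_norm)
    then show "t powr (-q) \<le> majorant q t \<zeta>" by (simp add: majorant_def max_def)
  qed (use t z e in \<open>auto intro: continuous_on_majorant\<close>)
  then show ?thesis using z by simp
qed

text \<open>Near the circle and at distance at least t from E, rho is almost constant on the arc of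
  angles within 1 - |z| of z, so the boundary function there is at least 9/10 of rho(z)^(-q). That
  arc has weight (1 + |z|) / (2 pi) \<ge> 5/36, and 9/10 * 5/36 = 1/8 matches the inner bound. The
  threshold depends on q and t, which is harmless because r may be taken arbitrarily close to
  1.\<close>

lemma majorant_bound_outer:
  assumes t: "0 < t" and q: "0 \<le> q"
  shows "\<exists>r0<1. \<forall>z. r0 < norm z \<longrightarrow> norm z < 1 \<longrightarrow> t \<le> infdist z E \<longrightarrow>
    infdist z E powr (-q) \<le> 8 * Re (schwarz_integral (majorant q t) z)"
proof -
  have "((\<lambda>\<eta>. (1 + sqrt 2 * \<eta> / t) powr (-q)) \<longlongrightarrow> (1 + sqrt 2 * 0 / t) powr (-q)) (at_right 0)"
    using t by (intro tendsto_intros) auto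
  then have "((\<lambda>\<eta>. (1 + sqrt 2 * \<eta> / t) powr (-q)) \<longlongrightarrow> 1) (at_right 0)" by simp
  then have "\<forall>\<^sub>F \<eta> in at_right 0. 9/10 < (1 + sqrt 2 * \<eta> / t) powr (-q)"
    by (rule order_tendstoD) simp
  then obtain \<eta>0 where \<eta>0: "0 < \<eta>0" "\<And>\<eta>. 0 < \<eta> \<Longrightarrow> \<eta> < \<eta>0 \<Longrightarrow> 9/10 < (1 + sqrt 2 * \<eta> / t) powr (-q)"
    unfolding eventually_at_right_field by auto
  show ?thesis
  proof (intro exI[of _ "1 - \<eta>0"] conjI allI impI)
    fix z :: complex assume z: "1 - \<eta>0 < norm z" "norm z < 1" "t \<le> infdist z E"
    define \<eta> \<theta> where "\<eta> = 1 - norm z" and "\<theta> = Arg z"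
    have z_eq: "z = of_real (norm z) * cis \<theta>"
      using rcis_cmod_Arg[of z] by (simp add: \<theta>_def rcis_def)
    have eta: "0 < \<eta>" "\<eta> < \<eta>0" "\<eta> \<le> 1" using z by (auto simp: \<eta>_def)
    have near: "norm (cis \<phi> - z) \<le> sqrt 2 * (1 - norm z)" if "\<theta> - \<eta> \<le> \<phi>" "\<phi> \<le> \<theta> + \<eta>" for \<phi>
      using norm_cis_near[of "norm z" \<phi> \<theta>, folded z_eq] that z(2) by (simp add: \<eta>_def abs_le_iff)
    define c where "c = 9/10 * infdist z E powr (-q)"
    have le: "c * ((1 + norm z) * ((\<theta> + \<eta>) - (\<theta> - \<eta>)) / (4 * pi * (1 - norm z))) \<le> Re (schwarz_integral (majorant q t) z)"
    proof (rule Re_schwarz_integral_ge)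
      show "\<theta> + \<eta> \<le> \<theta> - \<eta> + 2*pi" using eta pi_gt3 by simp
      fix \<phi> assume "\<theta> - \<eta> \<le> \<phi>" "\<phi> \<le> \<theta> + \<eta>"
      then have "norm (cis \<phi> - z) \<le> sqrt 2 * \<eta>" using near by (simp add: \<eta>_def)
      then have "infdist (cis \<phi>) E \<le> infdist z E + sqrt 2 * \<eta>"
        using infdist_triangle[of "cis \<phi>" E z] by (simp add: dist_norm)
      \<comment> \<open>The assumption t \<le> rho(z) turns the additive error into a relative one
        that is uniform in z.\<close>
      also have "\<dots> \<le> infdist z E + sqrt 2 * \<eta> * (infdist z E / t)"
        using z(3) t eta by (intro add_left_mono mult_right_le_one_le mult_left_mono) (auto simp: field_simps)
      also have "\<dots> = infdist z E * (1 + sqrt 2 * \<eta> / t)" by (simp add: field_simps)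
      finally have "infdist (cis \<phi>) E \<le> infdist z E * (1 + sqrt 2 * \<eta> / t)" .
      moreover have "t \<le> infdist z E * (1 + sqrt 2 * \<eta> / t)"
        using mult_mono[of t "infdist z E" 1 "1 + sqrt 2 * \<eta> / t"] z(3) t eta by simp
      ultimately have "max t (infdist (cis \<phi>) E) \<le> infdist z E * (1 + sqrt 2 * \<eta> / t)" by simp
      then have "(infdist z E * (1 + sqrt 2 * \<eta> / t)) powr (-q) \<le> majorant q t (cis \<phi>)"
        unfolding majorant_def using t q by (intro powr_mono2') auto
      moreover have "(infdist z E * (1 + sqrt 2 * \<eta> / t)) powr (-q) =
          infdist z E powr (-q) * (1 + sqrt 2 * \<eta> / t) powr (-q)"
        by (rule powr_mult)
      moreover have "infdist z E powr (-q) * (9/10) \<le> infdist z E powr (-q) * (1 + sqrt 2 * \<eta> / t) powr (-q)"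
        using \<eta>0(2)[of \<eta>] eta by (intro mult_left_mono) auto
      ultimately show "c \<le> majorant q t (cis \<phi>)" by (simp add: c_def)
    qed (use z t eta near in \<open>auto simp: c_def intro: continuous_on_majorant\<close>)
    have eq: "(1 + norm z) * ((\<theta> + \<eta>) - (\<theta> - \<eta>)) / (4 * pi * (1 - norm z)) = (1 + norm z) / (2 * pi)"
      using eta by (simp add: \<eta>_def[symmetric] field_simps)
    have "c * (5/36) \<le> c * ((1 + norm z) / (2 * pi))"
    proof (rule mult_left_mono)
      show "5/36 \<le> (1 + norm z) / (2 * pi)"
      proof -
        have "pi \<le> 18/5" using pi_approx(2) by simp
        then have "10 * pi \<le> 36 * 1" by simp
        also have "\<dots> \<le> 36 * (1 + norm z)" by simp
        finally have "10 * pi \<le> 36 * (1 + norm z)" .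
        then show ?thesis by (simp add: field_simps)
      qed
    qed (simp add: c_def)
    also have "\<dots> \<le> Re (schwarz_integral (majorant q t) z)" using le unfolding eq .
    finally show "infdist z E powr (-q) \<le> 8 * Re (schwarz_integral (majorant q t) z)"
      by (simp add: c_def)
  next
    show "1 - \<eta>0 < 1" using \<eta>0 by simp
  qed
qed

text \<open>The product is continuous on the closed disk and equals 1 on the circle; uniform
  continuity transfers this to a thin annulus by comparing z with its radial projection
  \<open>sgn z\<close>.\<close>

lemma prod_blaschke_near_circle:
  assumes A: "finite A" "\<And>a. a \<in> A \<Longrightarrow> norm a < 1" and \<epsilon>: "0 < \<epsilon>"
  shows "\<exists>r0<1. \<forall>z. r0 < norm z \<longrightarrow> norm z < 1 \<longrightarrow> 1 - \<epsilon> \<le> (\<Prod>a\<in>A. norm (blaschke a z) ^ m a)"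
proof -
  define P where "P z = (\<Prod>a\<in>A. norm (blaschke a z) ^ m a)" for z
  have "continuous_on (cball 0 1) P"
    unfolding P_def blaschke_def using A blaschke_denom_nonzero
    by (intro continuous_intros) auto
  then have "uniformly_continuous_on (cball 0 1) P"
    by (rule compact_uniformly_continuous) simp
  then obtain d where d: "0 < d" "\<And>x y. x \<in> cball 0 1 \<Longrightarrow> y \<in> cball 0 1 \<Longrightarrow> dist y x < d \<Longrightarrow> dist (P y) (P x) < \<epsilon>"
    unfolding uniformly_continuous_on_def using \<epsilon> by metis
  have P1: "P z = 1" if "norm z = 1" for z
  proof -
    have "norm (blaschke a z) = 1" if "a \<in> A" for a
    proof (rule power2_eq_imp_eq)
      show "(norm (blaschke a z))\<^sup>2 = 1\<^sup>2"
        using norm_blaschke_squared[of a z] A(2)[OF that] \<open>norm z = 1\<close> by simp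
    qed simp_all
    then show ?thesis by (simp add: P_def)
  qed
  show ?thesis
  proof (intro exI[of _ "max 0 (1 - d)"] conjI allI impI)
    fix z :: complex assume z: "max 0 (1 - d) < norm z" "norm z < 1"
    have "norm (sgn z - z) = 1 - norm z"
    proof -
      have "of_real (norm z) * sgn z = z" by (simp add: sgn_eq)
      then have "sgn z - z = of_real (1 - norm z) * sgn z" by (simp add: left_diff_distrib)
      then show ?thesis using z by (simp add: norm_mult norm_sgn del: of_real_diff)
    qed
    then have "dist (P z) (P (sgn z)) < \<epsilon>"
      using z d(2)[of "sgn z" z] by (simp add: dist_norm norm_sgn norm_minus_commute)
    moreover have "P (sgn z) = 1" using z by (intro P1) (auto simp: norm_sgn)
    ultimately show "1 - \<epsilon> \<le> (\<Prod>a\<in>A. norm (blaschke a z) ^ m a)"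
      unfolding P_def[symmetric] by (simp add: dist_real_def abs_less_iff)
  qed (use d in auto)
qed

lemma annulus_frontier:
  assumes "z \<in> frontier {z. norm z < r \<and> t < infdist z E}"
  shows "norm z \<le> r \<and> t \<le> infdist z E \<and> (norm z = r \<or> infdist z E = t)"
proof -
  have op: "open {z::complex. norm z < r \<and> t < infdist z E}"
    by (intro open_Collect_conj open_Collect_less continuous_intros)
  have cl: "closure {z::complex. norm z < r \<and> t < infdist z E} \<subseteq> {z. norm z \<le> r \<and> t \<le> infdist z E}"
    by (intro closure_minimal closed_Collect_conj closed_Collect_le continuous_intros) auto
  from assms have "z \<in> closure {z. norm z < r \<and> t < infdist z E}" "z \<notin> {z. norm z < r \<and> t < infdist z E}"
    using op by (auto simp: frontier_def interior_open)
  with cl show ?thesis by force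
qed

text \<open>Comparison at 0 leaves exp(-8 D Re H(0)) bounded by the product of exp(-m_a (1 - |a|) /
  3), whence 24 = 8 * 3. Finite sets A are enough, since the full sum of nonnegative terms is the
  supremum of its finite subsums.\<close>

lemma zero_sum_bound:
  assumes f: "f holomorphic_on ball 0 1" and D: "0 \<le> D" and q: "0 \<le> q"
    and growth: "\<And>z. norm z < 1 \<Longrightarrow> norm (f z) \<le> exp (D * infdist z E powr (-q))"
    and f0: "1 \<le> norm (f 0)"
    and A: "finite A" "A \<noteq> {}" "A \<subseteq> disk_zeros f" "\<And>a. a \<in> A \<Longrightarrow> 90 * t \<le> infdist a E" and t: "0 < t"
  shows "(\<Sum>a\<in>A. real_of_int (zorder f a) * (1 - norm a)) \<le> 24 * D * Re (schwarz_integral (majorant q t) 0)"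
proof -
  define m where "m a = nat (zorder f a)" for a
  define H where "H = schwarz_integral (majorant q t)"
  define K where "K a = schwarz_integral (correction t a)" for a
  have nA: "norm a < 1" if "a \<in> A" for a using A(3) that by (auto simp: disk_zeros_def)
  have A0: "a \<noteq> 0" if "a \<in> A" for a using A(3) that f0 by (auto simp: disk_zeros_def)
  have nz: "\<exists>w\<in>ball 0 1. f w \<noteq> 0" using f0 by (intro bexI[of _ 0]) auto
  \<comment> \<open>Any zero in A gives 90 t \<le> rho(a) \<le> 2. This is the range of the arc
    estimates, and it also puts 0 in the region rho > t.\<close>
  have t45: "t \<le> 1/45"
  proof -
    obtain a where "a \<in> A" using A(2) by auto
    then show ?thesis using A(4)[of a] nA[of a] infdist_le_2[of a] by simp
  qed
  obtain g where g: "g holomorphic_on ball 0 1"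
    "\<And>z. norm z < 1 \<Longrightarrow> f z = g z * (\<Prod>a\<in>A. (z - a) ^ m a)"
  proof -
    have "\<exists>g. g holomorphic_on ball 0 1 \<and> (\<forall>z\<in>ball 0 1. f z = g z * (\<Prod>a\<in>A. (z - a) ^ nat (zorder f a)))"
      using nA by (intro factor_out_zeros A(1) f nz) auto
    then show thesis using that by (auto simp: m_def)
  qed
  \<comment> \<open>The quotient with the zeros already cancelled: g times the Blaschke
    denominators. It is holomorphic in the whole disk, wherever the zeros in A lie relative to the
    region.\<close>
  define F where "F z = g z * (\<Prod>a\<in>A. (1 - cnj a * z) ^ m a) * exp (- (\<Sum>a\<in>A. of_nat (m a) * K a z) - of_real (8 * D) * H z)" for z
  have H_hol: "H holomorphic_on ball 0 1"
    unfolding H_def by (intro schwarz_integral_holomorphic continuous_on_majorant t)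
  have K_hol: "K a holomorphic_on ball 0 1" if "a \<in> A" for a
    unfolding K_def using nA[OF that] by (intro schwarz_integral_holomorphic continuous_on_correction t)
  have F_hol: "F holomorphic_on ball 0 1"
    unfolding F_def by (intro holomorphic_intros g(1) H_hol K_hol)
  \<comment> \<open>Multiplied out rather than written as a quotient, so that it holds at the zeros
    in A as well.\<close>
  have F_eq: "norm (F z) * (\<Prod>a\<in>A. (norm (blaschke a z) * exp (Re (K a z))) ^ m a) = norm (f z) * exp (- 8 * D * Re (H z))"
    if z: "norm z < 1" for z
  proof -
    let ?B = "\<Prod>a\<in>A. (norm (blaschke a z) * exp (Re (K a z))) ^ m a" and ?P = "norm (\<Prod>a\<in>A. (1 - cnj a * z) ^ m a)" and ?S = "\<Sum>a\<in>A. real (m a) * Re (K a z)"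
    have "(norm (blaschke a z) * exp (Re (K a z))) ^ m a * norm ((1 - cnj a * z) ^ m a) =
        norm ((z - a) ^ m a) * exp (real (m a) * Re (K a z))" if "a \<in> A" for a
      using blaschke_denom_nonzero[of a z] nA[OF that] z
      by (simp add: blaschke_def norm_divide norm_power power_mult_distrib power_divide exp_of_nat_mult)
    then have "(\<Prod>a\<in>A. (norm (blaschke a z) * exp (Re (K a z))) ^ m a * norm ((1 - cnj a * z) ^ m a)) =
      (\<Prod>a\<in>A. norm ((z - a) ^ m a) * exp (real (m a) * Re (K a z)))" by (intro prod.cong) auto
    then have 1: "?B * ?P = norm (\<Prod>a\<in>A. (z - a) ^ m a) * exp ?S"
      by (simp add: prod.distrib exp_sum[OF A(1)] prod_norm)
    have "norm (F z) * ?B = norm (g z) * (?B * ?P) * (exp (- ?S) * exp (- 8 * D * Re (H z)))"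
      by (simp add: F_def norm_mult Re_sum exp_add[symmetric] minus_mult_left[symmetric])
    also have "\<dots> = norm (g z) * norm (\<Prod>a\<in>A. (z - a) ^ m a) * (exp ?S * exp (- ?S)) * exp (- 8 * D * Re (H z))"
      unfolding 1 by (simp only: mult.assoc)
    also have "exp ?S * exp (- ?S) = 1" by (simp add: exp_add[symmetric])
    finally show ?thesis using g(2)[OF z] by (simp add: norm_mult)
  qed
  have K0: "0 \<le> Re (K a z)" if "a \<in> A" "norm z < 1" for a z
    unfolding K_def using nA[OF that(1)] that(2) t
    by (intro Re_schwarz_integral_nonneg continuous_on_correction correction_nonneg)
  have F0: "norm (F 0) \<le> 1 / (1 - \<epsilon>)" if \<epsilon>: "0 < \<epsilon>" "\<epsilon> < 1" for \<epsilon>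
  proof -
    obtain r1 where r1: "r1 < 1" "\<And>z. r1 < norm z \<Longrightarrow> norm z < 1 \<Longrightarrow> t \<le> infdist z E \<Longrightarrow>
        infdist z E powr (-q) \<le> 8 * Re (H z)"
      using majorant_bound_outer[OF t q] unfolding H_def by blast
    obtain r2 where r2: "r2 < 1" "\<And>z. r2 < norm z \<Longrightarrow> norm z < 1 \<Longrightarrow>
        1 - \<epsilon> \<le> (\<Prod>a\<in>A. norm (blaschke a z) ^ m a)"
      using prod_blaschke_near_circle[OF A(1) nA \<epsilon>(1)] by metis
    obtain r where r: "max 0 (max r1 r2) < r" "r < 1" using r1(1) r2(1) dense[of "max 0 (max r1 r2)" 1] by auto
    let ?S = "{z::complex. norm z < r \<and> t < infdist z E}"
    have op: "open ?S" by (intro open_Collect_conj open_Collect_less continuous_intros)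
    have clos: "closure ?S \<subseteq> ball 0 1"
    proof -
      have "closure ?S \<subseteq> cball 0 r" by (rule closure_minimal) auto
      then show ?thesis using r by auto
    qed
    show ?thesis
    proof (rule maximum_modulus_frontier[of F ?S])
      show "F holomorphic_on interior ?S"
        by (rule holomorphic_on_subset[OF F_hol]) (use r op in \<open>auto simp: interior_open\<close>)
      show "continuous_on (closure ?S) F"
        by (rule continuous_on_subset[OF holomorphic_on_imp_continuous_on[OF F_hol] clos])
      show "bounded ?S" by (rule bounded_subset[of "ball 0 r"]) auto
      show "0 \<in> ?S" using r t45 infdist_ge[of 0] by auto
      fix z assume "z \<in> frontier ?S"
      then have z: "norm z \<le> r" "t \<le> infdist z E" "norm z = r \<or> infdist z E = t"
        using annulus_frontier by blast+
      have z1: "norm z < 1" using z r by simp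
      have maj: "infdist z E powr (-q) \<le> 8 * Re (H z)"
        using z(3)
      proof
        assume "norm z = r"
        then show ?thesis using r1(2)[OF _ z1 z(2)] r by simp
      next
        assume "infdist z E = t"
        then show ?thesis unfolding H_def using majorant_bound_inner[OF t t45 z1] by simp
      qed
      have "norm (f z) * exp (- 8 * D * Re (H z)) \<le> exp (D * infdist z E powr (-q)) * exp (- 8 * D * Re (H z))"
        using growth[OF z1] by (intro mult_right_mono) auto
      also have "\<dots> = exp (D * (infdist z E powr (-q) - 8 * Re (H z)))"
        by (simp add: exp_add[symmetric] algebra_simps)
      also have "\<dots> \<le> 1" using D maj by (simp add: mult_nonneg_nonpos)
      finally have le1: "norm (f z) * exp (- 8 * D * Re (H z)) \<le> 1" .
      have prod: "1 - \<epsilon> \<le> (\<Prod>a\<in>A. (norm (blaschke a z) * exp (Re (K a z))) ^ m a)"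
        using z(3)
      proof
        assume zr: "norm z = r"
        have "1 - \<epsilon> \<le> (\<Prod>a\<in>A. norm (blaschke a z) ^ m a)" using r2(2)[OF _ z1] zr r by simp
        also have "\<dots> \<le> (\<Prod>a\<in>A. (norm (blaschke a z) * exp (Re (K a z))) ^ m a)"
          using K0 z1 by (intro prod_mono conjI power_mono mult_right_mono)
            (auto simp: mult_le_cancel_left1)
        finally show ?thesis .
      next
        assume zt: "infdist z E = t"
        have "1 \<le> (\<Prod>a\<in>A. (norm (blaschke a z) * exp (Re (K a z))) ^ m a)"
          using one_le_corrected_blaschke[OF nA A(4) t z1 zt]
          by (intro prod_ge_1 one_le_power) (auto simp: K_def)
        then show ?thesis using \<epsilon> by simp
      qed
      have "norm (F z) * (1 - \<epsilon>) \<le> 1"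
        using mult_left_mono[OF prod norm_ge_zero[of "F z"]] F_eq[OF z1] le1 by simp
      then show "norm (F z) \<le> 1 / (1 - \<epsilon>)" using \<epsilon> by (simp add: field_simps)
    qed
  qed
  have "norm (F 0) \<le> 1"
  proof (rule field_le_mult_one_interval)
    fix x :: real assume x: "0 < x" "x < 1"
    then show "x * norm (F 0) \<le> 1" using F0[of "1 - x"] by (simp add: field_simps)
  qed
  have "1 * exp (- 8 * D * Re (H 0)) \<le> norm (f 0) * exp (- 8 * D * Re (H 0))"
    using f0 by (intro mult_right_mono) auto
  also have "\<dots> = norm (F 0) * (\<Prod>a\<in>A. (norm (blaschke a 0) * exp (Re (K a 0))) ^ m a)"
    by (rule F_eq[symmetric]) simp
  also have "\<dots> \<le> 1 * (\<Prod>a\<in>A. (norm (blaschke a 0) * exp (Re (K a 0))) ^ m a)"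
    using \<open>norm (F 0) \<le> 1\<close> by (intro mult_right_mono prod_nonneg) auto
  also have "\<dots> \<le> (\<Prod>a\<in>A. exp (real (m a) * (- (1/3) * (1 - norm a))))"
  proof -
    have "(norm (blaschke a 0) * exp (Re (K a 0))) ^ m a \<le> exp (real (m a) * (- (1/3) * (1 - norm a)))"
      if "a \<in> A" for a
    proof -
      \<comment> \<open>The Blaschke factor has modulus |a| at 0; of the decay exp(-(1 - |a|)) the
        correction gives back at most two thirds of the exponent.\<close>
      have "norm (blaschke a 0) \<le> exp (- (1 - norm a))"
        using exp_ge_add_one_self[of "- (1 - norm a)"] by (simp add: blaschke_def)
      moreover have "exp (Re (K a 0)) \<le> exp (2/3 * (1 - norm a))"
        unfolding K_def using Re_schwarz_integral_correction_0[OF nA[OF that] A(4)[OF that] t] by simp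
      ultimately have "norm (blaschke a 0) * exp (Re (K a 0)) \<le> exp (- (1 - norm a)) * exp (2/3 * (1 - norm a))"
        by (intro mult_mono) auto
      also have "\<dots> = exp (- (1/3) * (1 - norm a))" by (simp add: exp_add[symmetric] field_simps)
      finally have "(norm (blaschke a 0) * exp (Re (K a 0))) ^ m a \<le> exp (- (1/3) * (1 - norm a)) ^ m a"
        by (intro power_mono) auto
      then show ?thesis by (simp only: exp_of_nat_mult)
    qed
    then show ?thesis unfolding mult_1 by (intro prod_mono) auto
  qed
  also have "\<dots> = exp (- (1/3) * (\<Sum>a\<in>A. real (m a) * (1 - norm a)))"
    unfolding exp_sum[OF A(1), symmetric] by (simp add: sum_distrib_left mult_ac sum_negf)
  finally have "- 8 * D * Re (H 0) \<le> - (1/3) * (\<Sum>a\<in>A. real (m a) * (1 - norm a))"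
    by (simp only: mult_1 exp_le_cancel_iff)
  then have "(\<Sum>a\<in>A. real (m a) * (1 - norm a)) \<le> 24 * D * Re (H 0)" by simp
  moreover have "real (m a) = real_of_int (zorder f a)" if "a \<in> A" for a
  proof -
    have "0 < zorder f a"
      using zorder_exist_zero[OF f _ _ _ nz, of a] A(3) that by (auto simp: disk_zeros_def split: if_splits)
    then show ?thesis by (simp add: m_def)
  qed
  ultimately show ?thesis by (simp add: H_def)
qed

end

section \<open>Layer cake\<close>

lemma nn_integral_powr_from_0:
  assumes "0 < p" "0 \<le> c"
  shows "(\<integral>\<^sup>+ s. ennreal (p * s powr (p - 1)) * indicator {0..c} s \<partial>lborel) = ennreal (c powr p)"
proof -
  have "((\<lambda>s. p * s powr (p - 1)) has_integral p * (c powr (p - 1 + 1) / (p - 1 + 1))) {0..c}"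
    using assms by (intro has_integral_mult_right has_integral_powr_from_0) auto
  then have "((\<lambda>s. p * s powr (p - 1)) has_integral c powr p) {0..c}" using assms by simp
  from nn_integral_has_integral_lebesgue[OF _ this] show ?thesis
    using assms by (auto simp: indicator_mult_ennreal mult.commute)
qed

text \<open>The upper limit 2 is the largest value that rho can take on the closed disk.\<close>

lemma nn_integral_powr_minus:
  assumes q: "0 \<le> q" and b: "0 < b" "b \<le> 2"
  shows "(\<integral>\<^sup>+ u. ennreal (q * u powr (-q - 1)) * indicator {b..2} u \<partial>lborel) = ennreal (b powr (-q) - 2 powr (-q))"
proof -
  have "(\<integral>\<^sup>+ u. ennreal (q * u powr (-q - 1)) * indicator {b..2} u \<partial>lborel) = ennreal (- (2 powr (-q)) - - (b powr (-q)))"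
  proof (rule nn_integral_FTC_Icc)
    fix u :: real assume "u \<in> {b..2}"
    then show "((\<lambda>u. - (u powr (-q))) has_real_derivative q * u powr (-q - 1)) (at u)"
      using b by (auto intro!: derivative_eq_intros)
  qed (use q b in auto)
  then show ?thesis by simp
qed

section \<open>The circle measure and the function nu_E\<close>

lemma cis_measurable [measurable]: "cis \<in> borel_measurable borel"
  by (intro borel_measurable_continuous_onI continuous_intros)

lemma sets_circle_measure [measurable_cong, simp]: "sets circle_measure = sets borel"
  by (simp add: circle_measure_def)

lemma space_circle_measure [simp]: "space circle_measure = UNIV"
  by (simp add: circle_measure_def)

lemma nn_integral_circle_measure:
  assumes [measurable]: "g \<in> borel_measurable borel"
  shows "(\<integral>\<^sup>+ \<zeta>. g \<zeta> \<partial>circle_measure) =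
    (\<integral>\<^sup>+ \<phi>. g (cis \<phi>) * indicator {0..2*pi} \<phi> \<partial>lborel) / ennreal (2*pi)"
proof -
  have "(\<integral>\<^sup>+ \<zeta>. g \<zeta> \<partial>circle_measure) = (\<integral>\<^sup>+ \<phi>. g (cis \<phi>) \<partial>uniform_measure lborel {0..<2*pi})"
    unfolding circle_measure_def by (intro nn_integral_distr) (auto simp: uniform_measure_def)
  also have "\<dots> = (\<integral>\<^sup>+ \<phi>. g (cis \<phi>) * indicator {0..<2*pi} \<phi> \<partial>lborel) / ennreal (2*pi)"
    by (subst nn_integral_uniform_measure) auto
  also have "(\<integral>\<^sup>+ \<phi>. g (cis \<phi>) * indicator {0..<2*pi} \<phi> \<partial>lborel) =
      (\<integral>\<^sup>+ \<phi>. g (cis \<phi>) * indicator {0..2*pi} \<phi> \<partial>lborel)"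
    using AE_lborel_singleton[of "2*pi"] by (intro nn_integral_cong_AE) (auto simp: indicator_def)
  finally show ?thesis .
qed

lemma emeasure_circle_measure_UNIV: "emeasure circle_measure UNIV = 1"
proof -
  have "emeasure circle_measure UNIV = (\<integral>\<^sup>+ \<zeta>. 1 \<partial>circle_measure)" by simp
  also have "\<dots> = (\<integral>\<^sup>+ \<phi>. 1 * indicator {0..2*pi} \<phi> \<partial>lborel) / ennreal (2*pi)"
    by (rule nn_integral_circle_measure) simp
  also have "\<dots> = 1" by (simp add: divide_ennreal)
  finally show ?thesis .
qed

interpretation circle_measure: finite_measure circle_measure
  by standard (simp add: emeasure_circle_measure_UNIV)

interpretation circle_lborel: pair_sigma_finite circle_measure "lborel :: real measure"
  by standard

lemma AE_circle_measure: "AE \<zeta> in circle_measure. \<zeta> \<in> sphere 0 1"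
proof -
  have "AE \<phi> in uniform_measure lborel {0..<2*pi}. cis \<phi> \<in> sphere 0 1" by simp
  moreover have "cis \<in> measurable (uniform_measure lborel {0..<2*pi}) borel" by (simp add: uniform_measure_def)
  ultimately show ?thesis unfolding circle_measure_def by (subst AE_distr_iff) auto
qed

lemma ennreal_nu:
  "ennreal (nu E u) = (\<integral>\<^sup>+ \<zeta>. indicator {\<zeta>. infdist \<zeta> E < u} \<zeta> \<partial>circle_measure)"
proof -
  have nb [measurable]: "{\<zeta>. infdist \<zeta> E < u} \<in> sets borel"
    by (intro borel_open open_Collect_less continuous_intros)
  have [measurable]: "circle_nbhd E u \<in> sets borel"
  proof -
    have "circle_nbhd E u = sphere 0 1 \<inter> {\<zeta>. infdist \<zeta> E < u}" by (auto simp: circle_nbhd_def)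
    then show ?thesis by (simp only:) (intro sets.Int borel_closed closed_sphere nb)
  qed
  have "ennreal (nu E u) = emeasure circle_measure (circle_nbhd E u)"
    by (simp add: nu_def circle_measure.emeasure_eq_measure)
  also have "\<dots> = emeasure circle_measure {\<zeta>. infdist \<zeta> E < u}"
  proof (rule emeasure_eq_AE)
    show "AE \<zeta> in circle_measure. (\<zeta> \<in> circle_nbhd E u) = (\<zeta> \<in> {\<zeta>. infdist \<zeta> E < u})"
      using AE_circle_measure by eventually_elim (simp add: circle_nbhd_def)
  qed simp_all
  also have "\<dots> = (\<integral>\<^sup>+ \<zeta>. indicator {\<zeta>. infdist \<zeta> E < u} \<zeta> \<partial>circle_measure)" by simp
  finally show ?thesis .
qed

lemma nu_mono: "u \<le> v \<Longrightarrow> nu E u \<le> nu E v"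
proof -
  assume "u \<le> v"
  then have "ennreal (nu E u) \<le> ennreal (nu E v)"
    unfolding ennreal_nu by (intro nn_integral_mono) (auto simp: indicator_def)
  then show ?thesis by (simp add: nu_def)
qed

lemma borel_measurable_nu [measurable]: "nu E \<in> borel_measurable borel"
  by (rule borel_measurable_mono) (auto simp: mono_def intro: nu_mono)

lemma nu_nonneg [simp]: "0 \<le> nu E u"
  by (simp add: nu_def)

context closed_circle_set
begin

lemma ennreal_mean_majorant:
  assumes t: "0 < t"
  shows "ennreal (Re (schwarz_integral (majorant q t) 0)) = (\<integral>\<^sup>+ \<zeta>. ennreal (majorant q t \<zeta>) \<partial>circle_measure)"
proof -
  let ?I = "integral {0..2*pi} (\<lambda>\<phi>. majorant q t (cis \<phi>))"
  note cont = continuous_on_majorant[OF t, of _ q]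
  have "((\<lambda>\<phi>. majorant q t (cis \<phi>)) has_integral ?I) {0..2*pi}"
    by (intro integrable_integral integrable_continuous_real continuous_on_circle_param cont)
  from nn_integral_has_integral_lebesgue[OF _ this]
  have "(\<integral>\<^sup>+ \<phi>. ennreal (majorant q t (cis \<phi>)) * indicator {0..2*pi} \<phi> \<partial>lborel) = ennreal ?I"
    by (simp add: nn_integral_set_ennreal mult.commute)
  moreover have "majorant q t \<in> borel_measurable borel"
    by (intro borel_measurable_continuous_onI cont)
  ultimately have "(\<integral>\<^sup>+ \<zeta>. ennreal (majorant q t \<zeta>) \<partial>circle_measure) = ennreal ?I / ennreal (2*pi)"
    by (subst nn_integral_circle_measure) auto
  also have "\<dots> = ennreal (?I / (2*pi))"
    by (intro divide_ennreal integral_nonneg integrable_continuous_real continuous_on_circle_param cont) auto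
  finally show ?thesis
    using Re_schwarz_integral[OF cont, of 0] by simp
qed

text \<open>The mean of the majorant as a function of t, in a form whose Borel measurability in t is
  evident; this is needed when the scale is integrated out.\<close>

definition layer_cake :: "real \<Rightarrow> real \<Rightarrow> ennreal" where
  "layer_cake q t =
    ennreal (2 powr (-q)) + (\<integral>\<^sup>+ u. ennreal (q * u powr (-q - 1)) * indicator {t..2} u * ennreal (nu E u) \<partial>lborel)"

lemma borel_measurable_layer_cake [measurable]: "layer_cake q \<in> borel_measurable borel"
  unfolding layer_cake_def indicator_def atLeastAtMost_iff by measurable

text \<open>With b = max(t, rho), b^(-q) is 2^(-q) plus the integral of q u^(-q - 1) from b to 2.
  The condition b \<le> u splits into t \<le> u and rho \<le> u, and Tonelli turns the second one
  into nu_E.\<close>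

lemma mean_majorant_eq_layer_cake:
  assumes t: "0 < t" "t \<le> 2" and q: "0 \<le> q"
  shows "ennreal (Re (schwarz_integral (majorant q t) 0)) = layer_cake q t"
proof -
  let ?w = "\<lambda>u. ennreal (q * u powr (-q - 1)) * indicator {t..2} u"
  have [measurable]: "(\<lambda>\<zeta>. infdist \<zeta> E) \<in> borel_measurable borel"
    by (intro borel_measurable_continuous_onI continuous_intros)
  have meas: "(\<lambda>(\<zeta>, u). ?w u * indicator {\<zeta>. infdist \<zeta> E < u} \<zeta>) \<in> borel_measurable (circle_measure \<Otimes>\<^sub>M lborel)"
    unfolding indicator_def mem_Collect_eq by measurable
  have "ennreal (majorant q t \<zeta>) = ennreal (2 powr (-q)) + (\<integral>\<^sup>+ u. ?w u * indicator {\<zeta>. infdist \<zeta> E < u} \<zeta> \<partial>lborel)"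
    if "\<zeta> \<in> sphere 0 1" for \<zeta>
  proof -
    define b where "b = max t (infdist \<zeta> E)"
    have b: "0 < b" "b \<le> 2" using t infdist_le_2[of \<zeta>] that by (auto simp: b_def)
    have "(\<integral>\<^sup>+ u. ?w u * indicator {\<zeta>. infdist \<zeta> E < u} \<zeta> \<partial>lborel) =
        (\<integral>\<^sup>+ u. ennreal (q * u powr (-q - 1)) * indicator {b..2} u \<partial>lborel)"
      \<comment> \<open>The strict inequality in nu_E and the closed interval differ only at u =
        rho.\<close>
      using AE_lborel_singleton[of "infdist \<zeta> E"]
      by (intro nn_integral_cong_AE) (auto simp: indicator_def b_def)
    also have "\<dots> = ennreal (b powr (-q) - 2 powr (-q))" by (rule nn_integral_powr_minus[OF q b])
    also have "ennreal (2 powr (-q)) + \<dots> = ennreal (b powr (-q))"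
      using b q by (subst ennreal_plus[symmetric]) (auto intro!: powr_mono2')
    finally show ?thesis by (simp add: majorant_def b_def)
  qed
  then have "AE \<zeta> in circle_measure. ennreal (majorant q t \<zeta>) = ennreal (2 powr (-q)) + (\<integral>\<^sup>+ u. ?w u * indicator {\<zeta>. infdist \<zeta> E < u} \<zeta> \<partial>lborel)"
    using AE_circle_measure by auto
  then have "(\<integral>\<^sup>+ \<zeta>. ennreal (majorant q t \<zeta>) \<partial>circle_measure) =
     (\<integral>\<^sup>+ \<zeta>. ennreal (2 powr (-q)) + (\<integral>\<^sup>+ u. ?w u * indicator {\<zeta>. infdist \<zeta> E < u} \<zeta> \<partial>lborel) \<partial>circle_measure)"
    by (rule nn_integral_cong_AE)
  also have "\<dots> = ennreal (2 powr (-q)) + (\<integral>\<^sup>+ \<zeta>. (\<integral>\<^sup>+ u. ?w u * indicator {\<zeta>. infdist \<zeta> E < u} \<zeta> \<partial>lborel) \<partial>circle_measure)"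
    using lborel.borel_measurable_nn_integral[OF meas]
    by (subst nn_integral_add) (auto simp: emeasure_circle_measure_UNIV)
  also have "(\<integral>\<^sup>+ \<zeta>. (\<integral>\<^sup>+ u. ?w u * indicator {\<zeta>. infdist \<zeta> E < u} \<zeta> \<partial>lborel) \<partial>circle_measure) =
     (\<integral>\<^sup>+ u. (\<integral>\<^sup>+ \<zeta>. ?w u * indicator {\<zeta>. infdist \<zeta> E < u} \<zeta> \<partial>circle_measure) \<partial>lborel)"
    by (rule circle_lborel.Fubini'[OF meas, symmetric])
  also have "\<dots> = (\<integral>\<^sup>+ u. ?w u * ennreal (nu E u) \<partial>lborel)"
  proof (rule nn_integral_cong)
    fix u
    have [measurable]: "{\<zeta>. infdist \<zeta> E < u} \<in> sets borel" by measurable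
    show "(\<integral>\<^sup>+ \<zeta>. ?w u * indicator {\<zeta>. infdist \<zeta> E < u} \<zeta> \<partial>circle_measure) = ?w u * ennreal (nu E u)"
      unfolding ennreal_nu by (intro nn_integral_cmult) auto
  qed
  finally show ?thesis by (simp only: ennreal_mean_majorant[OF t(1)] layer_cake_def)
qed

lemma I_integral_eq:
  "I_integral \<alpha> E = (\<integral>\<^sup>+ u. ennreal (u powr (- \<alpha> - 1)) * indicator {0..2} u * ennreal (nu E u) \<partial>lborel)"
proof -
  have "s powr (- \<alpha> - 1) = inverse (s powr (\<alpha> + 1))" for s :: real
  proof -
    have "- \<alpha> - 1 = - (\<alpha> + 1)" by simp
    then show ?thesis by (simp only: powr_minus)
  qed
  then have "ennreal (nu E s / s powr (\<alpha> + 1)) = ennreal (s powr (- \<alpha> - 1)) * ennreal (nu E s)" for s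
    by (simp add: ennreal_mult[symmetric] divide_inverse mult.commute)
  then show ?thesis unfolding I_integral_def by (simp add: mult_ac)
qed

text \<open>For u \<le> 2 and q \<le> \<alpha>, u^(-q - 1) \<le> 2^(\<alpha> - q) u^(-\<alpha> - 1),
  so I(\<alpha>, E) controls the mean uniformly in t.\<close>

lemma mean_majorant_le:
  assumes t: "0 < t" "t \<le> 2" and q: "0 \<le> q" "q \<le> \<alpha>" and I: "I_integral \<alpha> E < \<infinity>"
  shows "Re (schwarz_integral (majorant q t) 0) \<le> 2 powr (-q) + q * 2 powr (\<alpha> - q) * enn2real (I_integral \<alpha> E)"
proof -
  have "(\<integral>\<^sup>+ u. ennreal (q * u powr (-q - 1)) * indicator {t..2} u * ennreal (nu E u) \<partial>lborel) \<le>
     (\<integral>\<^sup>+ u. ennreal (q * 2 powr (\<alpha> - q)) * (ennreal (u powr (- \<alpha> - 1)) * indicator {0..2} u * ennreal (nu E u)) \<partial>lborel)"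
  proof (rule nn_integral_mono)
    fix u :: real
    have "q * u powr (-q - 1) \<le> (q * 2 powr (\<alpha> - q)) * u powr (- \<alpha> - 1)" if "t \<le> u" "u \<le> 2"
    proof -
      have "u powr (-q - 1) = u powr (\<alpha> - q) * u powr (-\<alpha> - 1)" by (simp add: powr_add[symmetric])
      also have "\<dots> \<le> 2 powr (\<alpha> - q) * u powr (-\<alpha> - 1)"
        using that t q by (intro mult_right_mono powr_mono2) auto
      finally show ?thesis using q by (simp add: mult.assoc mult_left_mono)
    qed
    then have "ennreal (q * u powr (-q - 1)) * indicator {t..2} u \<le>
       ennreal (q * 2 powr (\<alpha> - q)) * (ennreal (u powr (- \<alpha> - 1)) * indicator {0..2} u)"
      using t q by (auto simp: indicator_def ennreal_mult[symmetric] intro!: ennreal_leI)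
    then show "ennreal (q * u powr (-q - 1)) * indicator {t..2} u * ennreal (nu E u) \<le>
      ennreal (q * 2 powr (\<alpha> - q)) * (ennreal (u powr (- \<alpha> - 1)) * indicator {0..2} u * ennreal (nu E u))"
      using mult_right_mono[of _ _ "ennreal (nu E u)"] by (fastforce simp: mult.assoc)
  qed
  also have "\<dots> = ennreal (q * 2 powr (\<alpha> - q)) * I_integral \<alpha> E"
    unfolding I_integral_eq by (rule nn_integral_cmult) measurable
  also have "\<dots> = ennreal (q * 2 powr (\<alpha> - q) * enn2real (I_integral \<alpha> E))"
    using I q by (simp add: ennreal_mult)
  finally have "ennreal (Re (schwarz_integral (majorant q t) 0)) \<le>
     ennreal (2 powr (-q)) + ennreal (q * 2 powr (\<alpha> - q) * enn2real (I_integral \<alpha> E))"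
    unfolding mean_majorant_eq_layer_cake[OF t q(1)] layer_cake_def by (rule add_left_mono)
  also have "\<dots> = ennreal (2 powr (-q) + q * 2 powr (\<alpha> - q) * enn2real (I_integral \<alpha> E))"
    using q by (subst ennreal_plus) auto
  finally show ?thesis using q by (subst (asm) ennreal_le_iff) auto
qed

text \<open>Put p = q - \<alpha>. After Tonelli, s / 90 \<le> u lets s run at most up to 90 u, and p
  s^(p - 1) integrates to (90 u)^p. Against u^(-q - 1) this leaves 90^p u^(-\<alpha> - 1), the
  weight in I(\<alpha>, E). The constant part gives 2^p 2^(-q) = 2^(-\<alpha>).\<close>

lemma integral_layer_cake_le:
  assumes q: "0 \<le> q" "\<alpha> < q" and I: "I_integral \<alpha> E < \<infinity>"
  shows "(\<integral>\<^sup>+ s. ennreal ((q - \<alpha>) * s powr (q - \<alpha> - 1)) * indicator {0..2} s *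
      layer_cake q (s / 90) \<partial>lborel) \<le>
    ennreal (2 powr (-\<alpha>) + q * 90 powr (q - \<alpha>) * enn2real (I_integral \<alpha> E))"
proof -
  define p where "p = q - \<alpha>"
  have p: "0 < p" using q by (simp add: p_def)
  let ?v = "\<lambda>s. ennreal (p * s powr (p - 1)) * indicator {0..2} s"
  let ?w = "\<lambda>u. ennreal (q * u powr (-q - 1)) * ennreal (nu E u)"
  have meas: "(\<lambda>(s, u). ?v s * (?w u * indicator {s/90..2} u)) \<in> borel_measurable (lborel \<Otimes>\<^sub>M lborel)"
    unfolding indicator_def atLeastAtMost_iff by measurable
  have "(\<integral>\<^sup>+ s. ?v s * layer_cake q (s / 90) \<partial>lborel) =
    (\<integral>\<^sup>+ s. ?v s * ennreal (2 powr (-q)) + (\<integral>\<^sup>+ u. ?v s * (?w u * indicator {s/90..2} u) \<partial>lborel) \<partial>lborel)"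
  proof (rule nn_integral_cong)
    fix s :: real
    have "(\<integral>\<^sup>+ u. ?v s * (?w u * indicator {s/90..2} u) \<partial>lborel) = ?v s * (\<integral>\<^sup>+ u. ?w u * indicator {s/90..2} u \<partial>lborel)"
      by (rule nn_integral_cmult) measurable
    then show "?v s * layer_cake q (s / 90) =
        ?v s * ennreal (2 powr (-q)) + (\<integral>\<^sup>+ u. ?v s * (?w u * indicator {s/90..2} u) \<partial>lborel)"
      unfolding layer_cake_def distrib_left by (simp add: mult_ac)
  qed
  also have "\<dots> = (\<integral>\<^sup>+ s. ?v s * ennreal (2 powr (-q)) \<partial>lborel) +
      (\<integral>\<^sup>+ s. (\<integral>\<^sup>+ u. ?v s * (?w u * indicator {s/90..2} u) \<partial>lborel) \<partial>lborel)"
    using lborel.borel_measurable_nn_integral[OF meas] by (intro nn_integral_add) auto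
  also have "(\<integral>\<^sup>+ s. ?v s * ennreal (2 powr (-q)) \<partial>lborel) = ennreal (2 powr p) * ennreal (2 powr (-q))"
    using nn_integral_powr_from_0[OF p, of 2] by (subst nn_integral_multc) auto
  also have "\<dots> = ennreal (2 powr (-\<alpha>))"
    by (simp add: p_def ennreal_mult[symmetric] powr_add[symmetric])
  finally have mean: "(\<integral>\<^sup>+ s. ?v s * layer_cake q (s / 90) \<partial>lborel) =
     ennreal (2 powr (-\<alpha>)) + (\<integral>\<^sup>+ s. (\<integral>\<^sup>+ u. ?v s * (?w u * indicator {s/90..2} u) \<partial>lborel) \<partial>lborel)" .
  have "(\<integral>\<^sup>+ s. (\<integral>\<^sup>+ u. ?v s * (?w u * indicator {s/90..2} u) \<partial>lborel) \<partial>lborel) =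
     (\<integral>\<^sup>+ u. (\<integral>\<^sup>+ s. ?v s * (?w u * indicator {s/90..2} u) \<partial>lborel) \<partial>lborel)"
    by (rule lborel_pair.Fubini'[OF meas, symmetric])
  also have "\<dots> \<le> (\<integral>\<^sup>+ u. ennreal (q * 90 powr p) * (ennreal (u powr (- \<alpha> - 1)) * indicator {0..2} u * ennreal (nu E u)) \<partial>lborel)"
  proof (rule nn_integral_mono)
    fix u :: real
    show "(\<integral>\<^sup>+ s. ?v s * (?w u * indicator {s/90..2} u) \<partial>lborel) \<le>
      ennreal (q * 90 powr p) * (ennreal (u powr (- \<alpha> - 1)) * indicator {0..2} u * ennreal (nu E u))"
    proof (cases "0 \<le> u \<and> u \<le> 2")
      case True
      have "(\<integral>\<^sup>+ s. ?v s * (?w u * indicator {s/90..2} u) \<partial>lborel) \<le>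
          (\<integral>\<^sup>+ s. ?w u * (ennreal (p * s powr (p - 1)) * indicator {0..90 * u} s) \<partial>lborel)"
        by (intro nn_integral_mono) (auto simp: indicator_def mult_ac)
      also have "\<dots> = ?w u * ennreal ((90 * u) powr p)"
        using True nn_integral_powr_from_0[OF p, of "90 * u"] by (subst nn_integral_cmult) auto
      also have "\<dots> = ennreal (q * u powr (-q - 1) * (90 * u) powr p) * ennreal (nu E u)"
        using q by (simp add: ennreal_mult mult_ac)
      also have "q * u powr (-q - 1) * (90 * u) powr p = q * 90 powr p * u powr (-\<alpha> - 1)"
      proof -
        have "q * u powr (-q - 1) * (90 * u) powr p = q * 90 powr p * (u powr (-q - 1) * u powr p)"
          by (simp only: powr_mult mult_ac)
        also have "u powr (-q - 1) * u powr p = u powr (-q - 1 + p)" by (simp only: powr_add)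
        also have "-q - 1 + p = -\<alpha> - 1" by (simp add: p_def)
        finally show ?thesis .
      qed
      finally show ?thesis using True q by (simp add: ennreal_mult mult_ac)
    next
      case False
      have "?v s * (?w u * indicator {s/90..2} u) = 0" for s
        using False by (auto simp: indicator_def)
      then show ?thesis by (simp only: nn_integral_const mult_zero_left zero_le)
    qed
  qed
  also have "\<dots> = ennreal (q * 90 powr p) * I_integral \<alpha> E"
    unfolding I_integral_eq by (rule nn_integral_cmult) measurable
  also have "\<dots> = ennreal (q * 90 powr p * enn2real (I_integral \<alpha> E))"
    using I q by (simp add: ennreal_mult)
  finally have "(\<integral>\<^sup>+ s. ?v s * layer_cake q (s / 90) \<partial>lborel) \<le>
      ennreal (2 powr (-\<alpha>)) + ennreal (q * 90 powr p * enn2real (I_integral \<alpha> E))"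
    unfolding mean by (rule add_left_mono)
  also have "\<dots> = ennreal (2 powr (-\<alpha>) + q * 90 powr p * enn2real (I_integral \<alpha> E))"
    using q by (subst ennreal_plus) auto
  finally show ?thesis by (simp only: p_def)
qed

end

section \<open>The weighted sum\<close>

lemma zorder_pos_disk_zeros:
  assumes "f \<in> growth_class D q E" "a \<in> disk_zeros f"
  shows "0 < zorder f a"
proof -
  have "f holomorphic_on ball 0 1" "\<exists>w\<in>ball 0 1. f w \<noteq> 0"
    using assms by (auto simp: growth_class_def intro: analytic_imp_holomorphic)
  then show ?thesis
    using zorder_exist_zero[of f "ball 0 1" a] assms(2) by (auto simp: disk_zeros_def split: if_splits)
qed

lemma zero_term_nonneg:
  assumes "f \<in> growth_class D q E" "a \<in> disk_zeros f"
  shows "0 \<le> zero_term q' \<alpha> E f a"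
  unfolding zero_term_def using zorder_pos_disk_zeros[OF assms] assms(2)
  by (intro mult_nonneg_nonneg) (auto simp: disk_zeros_def)

context closed_circle_set
begin

lemma growth_class_zero_sum_bound:
  assumes f: "f \<in> growth_class D q E" and D: "0 \<le> D" and q: "0 \<le> q" and f0: "1 \<le> norm (f 0)"
    and A: "finite A" "A \<subseteq> disk_zeros f" "\<And>a. a \<in> A \<Longrightarrow> 90 * t \<le> infdist a E" and t: "0 < t"
  shows "(\<Sum>a\<in>A. real_of_int (zorder f a) * (1 - norm a)) \<le> 24 * D * Re (schwarz_integral (majorant q t) 0)"
proof (cases "A = {}")
  case True
  have "0 \<le> Re (schwarz_integral (majorant q t) 0)"
    by (intro Re_schwarz_integral_nonneg continuous_on_majorant t) auto
  then show ?thesis using True D by simp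
next
  case False
  show ?thesis
  proof (rule zero_sum_bound[OF _ D q _ f0 A(1) False A(2,3) t])
    show "f holomorphic_on ball 0 1"
      using f by (auto simp: growth_class_def intro: analytic_imp_holomorphic)
    show "norm (f z) \<le> exp (D * infdist z E powr (-q))" if "norm z < 1" for z
      using f that by (auto simp: growth_class_def powr_minus_divide)
  qed
qed

text \<open>The exponent is 0, so all distance weights are 1, and a single scale t below every
  rho(a) / 90 serves the finite set. The bound does not deteriorate as t shrinks.\<close>

lemma zero_term_sum_le_small_exponent:
  assumes f: "f \<in> growth_class D q E" and D: "0 \<le> D" and q: "0 \<le> q" "q \<le> \<alpha>" and f0: "1 \<le> norm (f 0)"
    and A: "finite A" "A \<subseteq> disk_zeros f" and I: "I_integral \<alpha> E < \<infinity>"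
  shows "sum (zero_term q \<alpha> E f) A \<le> 24 * (2 powr (-q) + q * 2 powr (\<alpha> - q) * enn2real (I_integral \<alpha> E)) * D"
proof -
  \<comment> \<open>The inserted 1 covers an empty A and keeps t \<le> 2.\<close>
  define t where "t = Min (insert 1 ((\<lambda>a. infdist a E / 90) ` A))"
  have pos: "0 < infdist a E" if "a \<in> A" for a
    using A(2) that infdist_pos[of a] by (auto simp: disk_zeros_def)
  have t: "0 < t" "t \<le> 2"
  proof -
    show "0 < t" unfolding t_def using A(1) pos by (subst Min_gr_iff) auto
    have "t \<le> 1" unfolding t_def using A(1) by (intro Min_le) auto
    then show "t \<le> 2" by simp
  qed
  have ta: "90 * t \<le> infdist a E" if "a \<in> A" for a
  proof -
    have "t \<le> infdist a E / 90" unfolding t_def using A(1) that by (intro Min_le) auto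
    then show ?thesis by simp
  qed
  have "sum (zero_term q \<alpha> E f) A = (\<Sum>a\<in>A. real_of_int (zorder f a) * (1 - norm a))"
    using q pos by (intro sum.cong) (auto simp: zero_term_def max_def less_imp_neq dest!: pos)
  also have "\<dots> \<le> 24 * D * Re (schwarz_integral (majorant q t) 0)"
    by (rule growth_class_zero_sum_bound[OF f D q(1) f0 A ta t(1)])
  also have "\<dots> \<le> 24 * D * (2 powr (-q) + q * 2 powr (\<alpha> - q) * enn2real (I_integral \<alpha> E))"
    using D by (intro mult_left_mono mean_majorant_le t q I) auto
  finally show ?thesis by (simp add: mult_ac)
qed

text \<open>With p = q - \<alpha>, rho(a)^p is the integral of p s^(p - 1) over [0, rho(a)]. Level s
  then carries only the zeros with rho(a) \<ge> s, to which the unweighted bound applies at scale s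
  / 90.\<close>

lemma zero_term_sum_le:
  assumes f: "f \<in> growth_class D q E" and D: "0 \<le> D" and q: "0 \<le> q" "\<alpha> < q" and f0: "1 \<le> norm (f 0)"
    and A: "finite A" "A \<subseteq> disk_zeros f" and I: "I_integral \<alpha> E < \<infinity>"
  shows "sum (zero_term q \<alpha> E f) A \<le> 24 * (2 powr (-\<alpha>) + q * 90 powr (q - \<alpha>) * enn2real (I_integral \<alpha> E)) * D"
proof -
  define p where "p = q - \<alpha>"
  have p: "0 < p" using q by (simp add: p_def)
  define w where "w a = real_of_int (zorder f a) * (1 - norm a)" for a
  let ?J = "\<lambda>s. Re (schwarz_integral (majorant q (s / 90)) 0)"
  let ?v = "\<lambda>s. ennreal (p * s powr (p - 1)) * indicator {0..2} s"
  have nA: "norm a < 1" if "a \<in> A" for a using A(2) that by (auto simp: disk_zeros_def)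
  have w0: "0 \<le> w a" if "a \<in> A" for a
    using zorder_pos_disk_zeros[OF f, of a] A(2) nA[OF that] that by (auto simp: w_def)
  have "ennreal (sum (zero_term q \<alpha> E f) A) = (\<Sum>a\<in>A. ennreal (w a * infdist a E powr p))"
  proof -
    have "sum (zero_term q \<alpha> E f) A = (\<Sum>a\<in>A. w a * infdist a E powr p)"
      using p by (intro sum.cong) (auto simp: zero_term_def w_def p_def max_def mult.assoc)
    then show ?thesis using w0 by (simp add: sum_ennreal)
  qed
  also have "\<dots> = (\<Sum>a\<in>A. ennreal (w a) * (\<integral>\<^sup>+ s. ennreal (p * s powr (p - 1)) * indicator {0..infdist a E} s \<partial>lborel))"
    using w0 by (intro sum.cong) (simp_all add: nn_integral_powr_from_0[OF p] ennreal_mult infdist_nonneg)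
  also have "\<dots> = (\<Sum>a\<in>A. (\<integral>\<^sup>+ s. ennreal (w a) * (ennreal (p * s powr (p - 1)) * indicator {0..infdist a E} s) \<partial>lborel))"
    by (intro sum.cong refl nn_integral_cmult[symmetric]) measurable
  also have "\<dots> = (\<integral>\<^sup>+ s. (\<Sum>a\<in>A. ennreal (w a) * (ennreal (p * s powr (p - 1)) * indicator {0..infdist a E} s)) \<partial>lborel)"
    by (rule nn_integral_sum[symmetric]) measurable
  also have "\<dots> \<le> (\<integral>\<^sup>+ s. ennreal (24 * D) * (?v s * layer_cake q (s / 90)) \<partial>lborel)"
  \<comment> \<open>The null level s = 0 is discarded because the scale s / 90 must be
    positive.\<close>
  proof (rule nn_integral_mono_AE, use AE_lborel_singleton[of 0] in eventually_elim)
    fix s :: real assume "s \<noteq> 0"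
    define B where "B = {a \<in> A. s \<le> infdist a E}"
    show "(\<Sum>a\<in>A. ennreal (w a) * (ennreal (p * s powr (p - 1)) * indicator {0..infdist a E} s)) \<le>
       ennreal (24 * D) * (?v s * layer_cake q (s / 90))"
    proof (cases "0 < s \<and> s \<le> 2")
      case True
      have "(\<Sum>a\<in>A. ennreal (w a) * (ennreal (p * s powr (p - 1)) * indicator {0..infdist a E} s)) =
          (\<Sum>a\<in>B. ennreal (w a) * ennreal (p * s powr (p - 1)))"
        unfolding B_def using A(1) True by (intro sum.mono_neutral_cong_right) (auto simp: indicator_def)
      also have "\<dots> = ennreal (sum w B) * ennreal (p * s powr (p - 1))"
      proof -
        have "(\<Sum>a\<in>B. ennreal (w a)) = ennreal (sum w B)"
          using w0 by (intro sum_ennreal) (auto simp: B_def)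
        then show ?thesis by (simp add: sum_distrib_right[symmetric])
      qed
      also have "\<dots> \<le> ennreal (24 * D * ?J s) * ennreal (p * s powr (p - 1))"
      proof (intro mult_right_mono ennreal_leI)
        show "sum w B \<le> 24 * D * ?J s"
          unfolding w_def
          by (rule growth_class_zero_sum_bound[OF f D q(1) f0]) (use A True in \<open>auto simp: B_def\<close>)
      qed simp
      also have "\<dots> = ennreal (24 * D) * (?v s * layer_cake q (s / 90))"
        using True D mean_majorant_eq_layer_cake[of "s / 90" q] q(1) by (simp add: ennreal_mult' mult_ac)
      finally show ?thesis .
    next
      case False
      have "s \<notin> {0..infdist a E}" if "a \<in> A" for a
        using False \<open>s \<noteq> 0\<close> infdist_le_2[of a] nA[OF that] by auto
      then have "(\<Sum>a\<in>A. ennreal (w a) * (ennreal (p * s powr (p - 1)) * indicator {0..infdist a E} s)) = 0"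
        by (intro sum.neutral) (simp add: indicator_def)
      then show ?thesis by (simp only: zero_le)
    qed
  qed
  also have "\<dots> \<le> ennreal (24 * D) * ennreal (2 powr (-\<alpha>) + q * 90 powr p * enn2real (I_integral \<alpha> E))"
  proof -
    have "(\<integral>\<^sup>+ s. ennreal (24 * D) * (?v s * layer_cake q (s / 90)) \<partial>lborel) = ennreal (24 * D) * (\<integral>\<^sup>+ s. ?v s * layer_cake q (s / 90) \<partial>lborel)"
      by (rule nn_integral_cmult) measurable
    also have "\<dots> \<le> ennreal (24 * D) * ennreal (2 powr (-\<alpha>) + q * 90 powr p * enn2real (I_integral \<alpha> E))"
      unfolding p_def by (intro mult_left_mono integral_layer_cake_le q I) simp
    finally show ?thesis .
  qed
  also have "\<dots> = ennreal (24 * D * (2 powr (-\<alpha>) + q * 90 powr p * enn2real (I_integral \<alpha> E)))"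
    using D by (simp add: ennreal_mult')
  finally have "sum (zero_term q \<alpha> E f) A \<le> 24 * D * (2 powr (-\<alpha>) + q * 90 powr p * enn2real (I_integral \<alpha> E))"
    using D q by (subst (asm) ennreal_le_iff) auto
  then show ?thesis by (simp add: p_def mult_ac)
qed

text \<open>The estimates give 24, raised to 36 to match the stated constant. Uniform bounds on
  finite subsums yield both the summability and the inequality for the infinite sum.\<close>

lemma zero_term_finite_sums_bounded:
  assumes q: "0 \<le> q" and I: "I_integral \<alpha> E < \<infinity>"
  shows "\<exists>C. (\<forall>D\<ge>0. \<forall>f\<in>growth_class D q E. norm (f 0) \<ge> 1 \<longrightarrow>
            (\<forall>A. finite A \<longrightarrow> A \<subseteq> disk_zeros f \<longrightarrow> sum (zero_term q \<alpha> E f) A \<le> C * D)) \<and>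
         (q > \<alpha> \<longrightarrow> C = 36 * (2 powr (-\<alpha>) + q * 90 powr (q - \<alpha>) * enn2real (I_integral \<alpha> E)))"
proof (cases "\<alpha> < q")
  case True
  let ?K = "2 powr (-\<alpha>) + q * 90 powr (q - \<alpha>) * enn2real (I_integral \<alpha> E)"
  have "0 \<le> ?K" using q by simp
  then have "24 * ?K * D \<le> 36 * ?K * D" if "0 \<le> D" for D
    using that by (intro mult_right_mono) auto
  then show ?thesis
    using zero_term_sum_le[OF _ _ q True _ _ _ I] by (intro exI[of _ "36 * ?K"]) (blast intro: order_trans)
next
  case False
  then show ?thesis
    using zero_term_sum_le_small_exponent[OF _ _ q _ _ _ _ I]
    by (intro exI[of _ "24 * (2 powr (-q) + q * 2 powr (\<alpha> - q) * enn2real (I_integral \<alpha> E))"]) auto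
qed

text \<open>Reduces summability for general f to the case |f(0)| \<ge> 1: divide by z^n, then by the
  value at 0. Since rho \<le> 2, a constant factor can be absorbed into exp(D' / rho^q) with a
  larger D'. Only the zero at the origin is lost.\<close>

lemma growth_class_normalize:
  assumes f: "f \<in> growth_class D q E" and D: "0 \<le> D" and q: "0 \<le> q"
  obtains D' g where "0 \<le> D'" "g \<in> growth_class D' q E" "norm (g 0) = 1"
    "disk_zeros g = disk_zeros f - {0}" "\<And>a. a \<in> disk_zeros g \<Longrightarrow> zorder g a = zorder f a"
proof -
  have hol: "f holomorphic_on ball 0 1" and nz: "\<exists>w\<in>ball 0 1. f w \<noteq> 0"
    and gr: "\<And>z. norm z < 1 \<Longrightarrow> norm (f z) \<le> exp (D / infdist z E powr q)"
    using f by (auto simp: growth_class_def intro: analytic_imp_holomorphic)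
  define n where "n = nat (zorder f 0)"
  obtain h where h: "h holomorphic_on ball 0 1" "h 0 \<noteq> 0"
    "\<And>z. z \<in> ball 0 1 \<Longrightarrow> f z = (z - 0) ^ n * h z"
    "\<And>b. b \<in> ball 0 1 \<Longrightarrow> b \<noteq> 0 \<Longrightarrow> zorder h b = zorder f b"
    using factor_out_zero[OF hol, of 0] nz unfolding n_def by auto
  have "continuous_on (cball 0 (1/2)) h"
    by (rule continuous_on_subset[OF holomorphic_on_imp_continuous_on[OF h(1)]]) auto
  then have "bounded (h ` cball 0 (1/2))"
    by (intro compact_imp_bounded compact_continuous_image) auto
  then obtain M0 where "\<forall>x\<in>h ` cball 0 (1/2). norm x \<le> M0"
    unfolding bounded_iff by blast
  then have M0: "norm (h z) \<le> M0" if "norm z \<le> 1/2" for z using that by simp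
  \<comment> \<open>Compactness controls h near 0, where division by z^n is harmful; for |z| > 1/2
    it costs at most 2^n.\<close>
  define M where "M = max M0 (2 ^ n)"
  have hM: "norm (h z) \<le> M * exp (D / infdist z E powr q)" if z: "norm z < 1" for z
  proof (cases "norm z \<le> 1/2")
    case True
    have "M * 1 \<le> M * exp (D / infdist z E powr q)"
      using D by (intro mult_left_mono) (auto simp: M_def le_max_iff_disj)
    then show ?thesis using M0[OF True] by (simp add: M_def)
  next
    case False
    then have "(1/2) ^ n * norm (h z) \<le> norm z ^ n * norm (h z)"
      by (intro mult_right_mono power_mono) auto
    also have "\<dots> = norm (f z)" using h(3)[of z] z by (simp add: norm_mult norm_power)
    finally have "norm (h z) \<le> 2 ^ n * norm (f z)" by (simp add: power_divide field_simps)
    also have "\<dots> \<le> M * exp (D / infdist z E powr q)"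
      using gr[OF z] by (intro mult_mono) (auto simp: M_def le_max_iff_disj)
    finally show ?thesis .
  qed
  \<comment> \<open>At least 1, so that ln N \<ge> 0 and D' stays nonnegative.\<close>
  define N where "N = max 1 (M / norm (h 0))"
  define g where "g z = inverse (h 0) * h z" for z
  define D' where "D' = D + 2 powr q * ln N"
  have N: "1 \<le> N" by (simp add: N_def)
  have ghol: "g holomorphic_on ball 0 1"
    unfolding g_def by (intro holomorphic_intros h(1))
  have gN: "norm (g z) \<le> exp (D' / infdist z E powr q)" if z: "norm z < 1" for z
  proof -
    have "norm (g z) = norm (h z) / norm (h 0)"
      by (simp add: g_def norm_divide divide_inverse mult.commute norm_mult norm_inverse)
    then have "norm (g z) \<le> (M / norm (h 0)) * exp (D / infdist z E powr q)"
      using divide_right_mono[OF hM[OF z], of "norm (h 0)"] by simp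
    also have "\<dots> \<le> N * exp (D / infdist z E powr q)" by (intro mult_right_mono) (auto simp: N_def)
    also have "N \<le> exp (2 powr q * ln N / infdist z E powr q)"
    proof -
      have "infdist z E powr q \<le> 2 powr q"
        using infdist_le_2[of z] infdist_pos[OF z] z q by (intro powr_mono2) auto
      then have "ln N * infdist z E powr q \<le> ln N * 2 powr q" using N by (intro mult_left_mono) auto
      then have "ln N \<le> 2 powr q * ln N / infdist z E powr q"
        using infdist_pos[OF z] by (simp add: field_simps)
      then show ?thesis using N by (metis exp_le_cancel_iff exp_ln less_le_trans zero_less_one)
    qed
    also have "exp (2 powr q * ln N / infdist z E powr q) * exp (D / infdist z E powr q) = exp (D' / infdist z E powr q)"
      by (simp add: exp_add[symmetric] D'_def add_divide_distrib add.commute)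
    finally show ?thesis by (simp add: mult_right_mono)
  qed
  show thesis
  proof (rule that[of D' g])
    show "0 \<le> D'" using D N by (simp add: D'_def)
    show "norm (g 0) = 1" using h(2) by (simp add: g_def)
    show "g \<in> growth_class D' q E"
      unfolding growth_class_def using ghol gN h(2)
      by (auto simp: analytic_on_open g_def intro!: bexI[of _ 0])
    show dz: "disk_zeros g = disk_zeros f - {0}"
      using h(2,3) by (auto simp: disk_zeros_def g_def)
    show "zorder g a = zorder f a" if "a \<in> disk_zeros g" for a
      using that h(4)[of a] zorder_cmult[of "inverse (h 0)" h a] h(2) unfolding dz
      by (simp add: g_def[abs_def] disk_zeros_def)
  qed
qed

end

theorem theorem3:
  fixes E :: "complex set" and \<alpha> q :: real
  assumes "closed E" and "E \<subseteq> sphere 0 1" and "E \<noteq> {}"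
    and "I_integral \<alpha> E < \<infinity>"
    and "q \<ge> 0"
  shows "(\<forall>D\<ge>0. \<forall>f\<in>growth_class D q E.
            zero_term q \<alpha> E f summable_on disk_zeros f) \<and>
         (\<exists>C::real.
            (\<forall>D\<ge>0. \<forall>f\<in>growth_class D q E. norm (f 0) \<ge> 1 \<longrightarrow>
               infsum (zero_term q \<alpha> E f) (disk_zeros f) \<le> C * D) \<and>
            (q > \<alpha> \<longrightarrow>
               C = 36 * (2 powr (-\<alpha>) + q * 90 powr (q - \<alpha>) * enn2real (I_integral \<alpha> E))))"
proof -
  interpret closed_circle_set E by standard fact+
  obtain C where C: "\<And>D f A. 0 \<le> D \<Longrightarrow> f \<in> growth_class D q E \<Longrightarrow> norm (f 0) \<ge> 1 \<Longrightarrow>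
      finite A \<Longrightarrow> A \<subseteq> disk_zeros f \<Longrightarrow> sum (zero_term q \<alpha> E f) A \<le> C * D"
    and C_eq: "q > \<alpha> \<longrightarrow> C = 36 * (2 powr (-\<alpha>) + q * 90 powr (q - \<alpha>) * enn2real (I_integral \<alpha> E))"
    using zero_term_finite_sums_bounded[OF assms(5,4)] by metis
  have summ: "zero_term q \<alpha> E f summable_on disk_zeros f"
    if "0 \<le> D" "f \<in> growth_class D q E" "norm (f 0) \<ge> 1" for D f
  proof (rule nonneg_bdd_above_summable_on)
    show "bdd_above (sum (zero_term q \<alpha> E f) ` {F. F \<subseteq> disk_zeros f \<and> finite F})"
      using C[OF that] by (intro bdd_aboveI[of _ "C * D"]) auto
  qed (rule zero_term_nonneg[OF that(2)])
  have "zero_term q \<alpha> E f summable_on disk_zeros f"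
    if D: "0 \<le> D" and f: "f \<in> growth_class D q E" for D f
  proof (rule growth_class_normalize[OF f D assms(5)])
    fix D' g assume g: "0 \<le> D'" "g \<in> growth_class D' q E" "norm (g 0) = 1"
      "disk_zeros g = disk_zeros f - {0}" "\<And>a. a \<in> disk_zeros g \<Longrightarrow> zorder g a = zorder f a"
    have "zero_term q \<alpha> E g summable_on disk_zeros g" using summ[OF g(1,2)] g(3) by simp
    then have "zero_term q \<alpha> E f summable_on disk_zeros g"
      by (rule summable_on_cong[THEN iffD1, rotated]) (simp add: zero_term_def g(5))
    \<comment> \<open>One more term restores a possible zero at the origin; if there is none, the
      superset is cut down again.\<close>
    then have "zero_term q \<alpha> E f summable_on insert 0 (disk_zeros g)"
      by (simp add: summable_on_insert_iff)
    then show ?thesis by (rule summable_on_subset_banach) (use g(4) in auto)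
  qed
  moreover have "infsum (zero_term q \<alpha> E f) (disk_zeros f) \<le> C * D"
    if "0 \<le> D" "f \<in> growth_class D q E" "norm (f 0) \<ge> 1" for D f
    by (rule infsum_le_finite_sums[OF summ[OF that] C[OF that]])
  ultimately show ?thesis using C_eq by blast
qed

end
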